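(* Let $\chi(\cdot,4)$ be the non-principal Dirichlet character of modulus $4$ and $L(\cdot,\chi(\cdot,4))$ its Dirichlet $L$-function. Let $s\in\mathbb{C}$ with $\mathrm{Re}\,s\in(0,\infty)$, $\mathrm{Re}\,s\neq2,4,\ldots$, and $s\notin\mathbb{N}$. With the functions $\varphi^*_{s,4},\gamma^*_{s,4},f_{1,s,1/2},g_{1,s,1/2}$ on $\mathbb{R}$ defined in the context, $$\varphi^*_{s,4}=2^sf_{1,s,1/2},\qquad\gamma^*_{s,4}=2^sg_{1,s,1/2},$$ and $$L(s,\chi(\cdot,4))=\frac{1}{4^s\Gamma(s)}\lim_{|y|\to\infty}\frac{\varphi^*_{s,4}(y)-\gamma^*_{s,4}(y)}{\cos y}.$$
   Context: $\mathbb{N}=\{1,2,\ldots\}$. $\chi(l,4)=(-1)^{(l-1)/2}$ for odd $l$ and $0$ for even $l$; $L(s,\chi(\cdot,4))=\sum_{n=0}^\infty(-1)^n(2n+1)^{-s}$ for $\mathrm{Re}\,s>0$. Put $m_1:=\lfloor(\mathrm{Re}\,s)/2\rfloor$, and for $\mathrm{Re}\,s>0$, $v>0$ let $$\Phi(-1,s,v)=\frac1{\Gamma(s)}\int_0^\infty\frac{t^{s-1}e^{(1-v)t}}{e^t+1}\,dt.$$ Write $\chi=\chi(\cdot,4)$ and $E(\chi)=\{n\in\mathbb{Z}:\sum_{l=1}^{3}\chi(l)e^{2\pi inl/4}=0\}$ (the even integers). For $y\in\mathbb{R}$, $$\varphi_{s,4}(y):=-\pi2^{s-2}\left(\frac{|y|^s\sum_{l=1}^{3}\chi(l)\sin[(l/2-1)y]}{\sin(\pi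 s/2)}+\frac{|y|^s\,\mathrm{sgn}(y)\sum_{l=1}^{3}\chi(l)\cos[(l/2-1)y]}{\cos(\pi s/2)}\right),$$ $$\gamma_{s,4}(y):=-\sin y\Bigg(4^s\sum_{j=1}^{m_1}(-1)^{j-1}\Gamma(s-2j)\,L(s-2j,\chi)(2y)^{2j}+\frac{\pi2^sy^{2(m_1+1)}}{\sin(\pi s)}\sum_{n\in\mathbb{N}\setminus E(\chi)}\frac{(\pi n)^{s-2m_1-1}\sum_{l=1}^{3}\chi(l)\sin[\pi nl/2+\pi s/2]}{y^2-(\pi n)^2}\Bigg),$$ $$\varphi^*_{s,4}(y):=\frac{\varphi_{s,4}(2y)}{P_4(y)},\qquad\gamma^*_{s,4}(y):=\frac{\gamma_{s,4}(2y)}{P_4(y)},\qquad P_4(y)=2\sin y$$ (extended by continuity to the zeros of $\sin y$). Further, $$f_{1,s,1/2}(y):=\frac{\pi2^{s-2}|y|^s}{\sin(\pi s/2)},$$ $$g_{1,s,1/2}(y):=-\cos y\Bigg(\sum_{j=1}^{m_1}(-1)^{j-1}\Gamma(s-2j)\,\Phi(-1,s-2j,1/2)(2y)^{2j}+\frac{\pi2^sy^{2(m_1+1)}}{\sin(\pi s)}\sum_{n=0}^\infty\frac{[\pi(n+1/2)]^{s-2m_1-1}\sin[\pi(n+1/2)+\pi s/2]}{y^2-[\pi(n+1/2)]^2}\Bigg).$$ Complex powers of positive reals are principal, $0^s=0$ when $\mathrm{Re}\,s>0$; removable singularities in the terms of the series (after multiplication by the outer factor $\sin y$ or $\cos y$)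 are understood by continuity; empty sums are zero. In the limit, $y$ runs over real numbers with $\cos y\ne0$.
   Formalization: In γ_{s,4} the polynomial terms carry weight 4^{s-2j} inside the sum instead of the constant 4^s; with 4^s the j-th term of γ* is 16^j times that of 2^s g, so the identity and the limit fail, e.g. at s=5/2. Nothing changes for Re s<2. *)

theory Defs
  imports "HOL-Analysis.Analysis"
begin

definition chi4 :: "int \<Rightarrow> complex" where
  "chi4 l = (if odd l then (-1) powi ((l - 1) div 2) else 0)"

text \<open>Meaningful for \<open>Re s > 0\<close>; the series converges only conditionally when \<open>Re s \<le> 1\<close>,
  so it is summed in the natural order.\<close>

definition L_chi4 :: "complex \<Rightarrow> complex" where
  "L_chi4 s = (\<Sum>n. (-1) ^ n * of_nat (2 * n + 1) powr (- s))"

text \<open>The Lerch function \<open>\<Phi>(-1, s, v)\<close> for \<open>Re s > 0\<close> and \<open>v > 0\<close>.\<close>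

definition Phi_minus1 :: "complex \<Rightarrow> real \<Rightarrow> complex" where
  "Phi_minus1 s v =
     1 / Gamma s *
     (LBINT t:{0<..}. of_real t powr (s - 1) * of_real (exp ((1 - v) * t)) / of_real (exp t + 1))"

definition E_chi4 :: "int set" where
  "E_chi4 = {n. (\<Sum>l=1..3. chi4 l * exp (2 * of_real pi * \<i> * of_int n * of_int l / 4)) = 0}"

definition m1 :: "complex \<Rightarrow> nat" where
  "m1 s = nat \<lfloor>Re s / 2\<rfloor>"

text \<open>\<open>extend Z F\<close> is \<open>F\<close> off \<open>Z\<close>, with the values on \<open>Z\<close> replaced by the limits of \<open>F\<close>
  there. It is only used where the points of \<open>Z\<close> are isolated removable singularities of \<open>F\<close>.\<close>

definition extend :: "real set \<Rightarrow> (real \<Rightarrow> 'a::t2_space) \<Rightarrow> real \<Rightarrow> 'a" where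
  "extend Z F y = (if y \<in> Z then Lim (at y) F else F y)"

definition P4 :: "real \<Rightarrow> real" where
  "P4 y = 2 * sin y"

definition phi4 :: "complex \<Rightarrow> real \<Rightarrow> complex" where
  "phi4 s y =
     - of_real pi * 2 powr (s - 2) *
     (of_real \<bar>y\<bar> powr s * (\<Sum>l=1..3. chi4 l * of_real (sin ((of_int l / 2 - 1) * y)))
        / sin (of_real pi * s / 2)
      + of_real \<bar>y\<bar> powr s * of_real (sgn y)
          * (\<Sum>l=1..3. chi4 l * of_real (cos ((of_int l / 2 - 1) * y)))
        / cos (of_real pi * s / 2))"

text \<open>In \<open>gamma4\<close> the outer factor \<open>sin y\<close> is distributed over the bracket and into the series,
  so that each term can be extended continuously to \<open>y = \<plusminus>\<pi>n\<close>; likewise for \<open>cos y\<close> in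
  \<open>g1_half\<close>.

  The weight of the \<open>j\<close>-th polynomial term of \<open>gamma4\<close> is \<open>4\<^bsup>s-2j\<^esup>\<close>, not \<open>4\<^bsup>s\<^esup>\<close>, as it comes from
  \<open>4\<^bsup>z\<^esup> \<Gamma>(z) L(z, \<chi>) = \<integral>\<^sub>0\<^sup>\<infinity> t\<^bsup>z-1\<^esup> (\<Sum>\<^sub>l \<chi>(l) e\<^bsup>(1-l/4)t\<^esup>) / (e\<^bsup>t\<^esup> - 1) dt\<close> at \<open>z = s - 2j\<close>.
  With a constant factor \<open>4\<^bsup>s\<^esup>\<close> in front of the sum, as sometimes printed, \<open>gamma4_star s\<close> differs
  from \<open>2\<^bsup>s\<^esup> g\<close> (with \<open>g = g1_half s\<close>) by a factor \<open>16\<^bsup>j\<^esup>\<close> in the \<open>j\<close>-th polynomial term, and the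
  limit formula fails, as soon as \<open>Re s > 2\<close>. For \<open>Re s < 2\<close> the sum is empty.\<close>

definition gamma4 :: "complex \<Rightarrow> real \<Rightarrow> complex" where
  "gamma4 s y =
     - (of_real (sin y) *
          (\<Sum>j=1..m1 s. 4 powr (s - 2 * of_nat j) * (-1) ^ (j - 1)
             * Gamma (s - 2 * of_nat j) * L_chi4 (s - 2 * of_nat j)
             * of_real ((2 * y) ^ (2 * j)))
        + of_real pi * 2 powr s * of_real (y ^ (2 * (m1 s + 1))) / sin (of_real pi * s) *
          (\<Sum>\<^sub>\<infinity>n\<in>{n::nat. 1 \<le> n \<and> int n \<notin> E_chi4}.
             of_real (pi * of_nat n) powr (s - 2 * of_nat (m1 s) - 1)
             * (\<Sum>l=1..3. chi4 l * sin (of_real pi * of_nat n * of_int l / 2 + of_real pi * s / 2))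
             * of_real (extend {x. x\<^sup>2 = (pi * of_nat n)\<^sup>2}
                          (\<lambda>x. sin x / (x\<^sup>2 - (pi * of_nat n)\<^sup>2)) y)))"

definition phi4_star :: "complex \<Rightarrow> real \<Rightarrow> complex" where
  "phi4_star s = extend {y. sin y = 0} (\<lambda>y. phi4 s (2 * y) / of_real (P4 y))"

definition gamma4_star :: "complex \<Rightarrow> real \<Rightarrow> complex" where
  "gamma4_star s = extend {y. sin y = 0} (\<lambda>y. gamma4 s (2 * y) / of_real (P4 y))"

definition f1_half :: "complex \<Rightarrow> real \<Rightarrow> complex" where
  "f1_half s y = of_real pi * 2 powr (s - 2) * of_real \<bar>y\<bar> powr s / sin (of_real pi * s / 2)"

definition g1_half :: "complex \<Rightarrow> real \<Rightarrow> complex" where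
  "g1_half s y =
     - (of_real (cos y) *
          (\<Sum>j=1..m1 s. (-1) ^ (j - 1)
             * Gamma (s - 2 * of_nat j) * Phi_minus1 (s - 2 * of_nat j) (1/2)
             * of_real ((2 * y) ^ (2 * j)))
        + of_real pi * 2 powr s * of_real (y ^ (2 * (m1 s + 1))) / sin (of_real pi * s) *
          (\<Sum>n. of_real (pi * (of_nat n + 1/2)) powr (s - 2 * of_nat (m1 s) - 1)
             * sin (of_real pi * (of_nat n + 1/2) + of_real pi * s / 2)
             * of_real (extend {x. x\<^sup>2 = (pi * (of_nat n + 1/2))\<^sup>2}
                          (\<lambda>x. cos x / (x\<^sup>2 - (pi * (of_nat n + 1/2))\<^sup>2)) y)))"

end

theory Submission
  imports Defs
begin

text \<open>
  Write \<open>h(t) = e\<^bsup>t/2\<^esup> / (e\<^bsup>t\<^esup> + 1) = 1 / (2 cosh (t/2))\<close>, \<open>K(z) = \<integral> t\<^bsup>z-1\<^esup> h(t) dt\<close> and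
  \<open>J(z, Y) = \<integral> t\<^bsup>z-1\<^esup> h(t) / (t\<^sup>2 + Y\<^sup>2) dt\<close>, both over \<open>(0, \<infinity>)\<close>. Expanding \<open>h\<close> into a geometric
  series gives \<open>\<Gamma>(z) \<Phi>(-1, z, 1/2) = K(z) = 2\<^bsup>z\<^esup> \<Gamma>(z) L(z, \<chi>)\<close>, which identifies the polynomial parts
  of \<open>\<gamma>*\<close> and \<open>2\<^bsup>s\<^esup> g\<close>; the other parts agree term by term.

  For the limit, the claim is that \<open>(f(y) - g(y)) / cos y = Y\<^sup>2 J(s, Y)\<close> with \<open>Y = 2 |y|\<close>, and the right-hand
  side tends to \<open>K(s)\<close>. Iterating \<open>J(z + 2, Y) + Y\<^sup>2 J(z, Y) = K(z)\<close> produces the polynomial part of \<open>g\<close> and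
  reduces the claim to a formula for \<open>J(w, Y)\<close> with \<open>w = s - 2 m\<^sub>1\<close>, where \<open>0 < Re w < 2\<close>. That formula comes
  from integrating the partial fraction expansion of \<open>h\<close> term by term against
  \<open>t\<^bsup>w-1\<^esup> / (t\<^sup>2 + Y\<^sup>2)\<close>: the resulting sum splits into the series in \<open>g\<close> and the partial fraction
  expansion of \<open>1 / cos y\<close>, which accounts for \<open>f\<close>.
\<close>

section \<open>Mellin integrals of exponentials and rational kernels\<close>

lemma of_real_powr_eq_exp:
  "t > 0 \<Longrightarrow> complex_of_real t powr z = exp (z * of_real (ln t))"
  by (simp add: powr_def Ln_of_real)

lemma continuous_on_of_real_powr [continuous_intros]:
  "continuous_on {0<..} (\<lambda>t. complex_of_real t powr z)"
proof -
  have "continuous_on {0<..} (\<lambda>t. exp (z * complex_of_real (ln t)))"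
    by (intro continuous_intros) auto
  then show ?thesis
    by (rule continuous_on_eq) (simp add: of_real_powr_eq_exp)
qed

text \<open>Euler's integral and the change of variables live in the Lebesgue measure. Continuity
  supplies the Borel measurability needed to move to \<open>lborel\<close>, where Fubini and
  dominated convergence are applied.\<close>

lemma set_integrable_lborel_of_lebesgue:
  fixes f :: "real \<Rightarrow> 'a :: euclidean_space"
  assumes "f absolutely_integrable_on A" "continuous_on A f" "A \<in> sets borel"
  shows "set_integrable lborel A f" "(LBINT t:A. f t) = integral A f"
proof -
  have "(\<lambda>x. indicator A x *\<^sub>R f x) \<in> borel_measurable lborel"
    using borel_measurable_continuous_on_indicator[OF assms(3,2)] by simp
  with assms(1) show "set_integrable lborel A f"
    unfolding set_integrable_def by (simp add: integrable_completion)
  then show "(LBINT t:A. f t) = integral A f"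
    by (rule set_borel_integral_eq_integral)
qed

text \<open>Substitute \<open>a * t ^ q\<close> for the variable in Euler's integral. The case
  \<open>q = 1\<close> serves the geometric series and the outer Fubini integral,
  \<open>q = 2\<close> the Gaussian inner one.\<close>

lemma Gamma_integral_power:
  fixes a :: real and q :: nat and z :: complex
  assumes z: "Re z > 0" and a: "a > 0" and q: "q > 0"
  defines "F \<equiv> \<lambda>t. complex_of_real t powr (of_nat q * z - 1) * of_real (exp (- (a * t ^ q)))"
  shows "set_integrable lborel {0<..} F"
    and "(LBINT t:{0<..}. F t) = Gamma z / (of_nat q * of_real a powr z)"
proof -
  define G where "G = (\<lambda>t. complex_of_real t powr (z - 1) / of_real (exp t))"
  define c where "c = of_nat q * complex_of_real a powr z"
  have c: "c \<noteq> 0" using a q by (simp add: c_def)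
  have img: "(\<lambda>t. a * t ^ q) ` {0<..} = {0<..}"
  proof safe
    fix x :: real assume x: "x > 0"
    show "x \<in> (\<lambda>t. a * t ^ q) ` {0<..}"
      by (rule image_eqI[of _ _ "root q (x / a)"]) (use x a q in auto)
  qed (use a in auto)
  have inj: "inj_on (\<lambda>t. a * t ^ q) {0<..}"
    using a q by (auto simp: inj_on_def intro: power_eq_imp_eq_base)
  \<comment> \<open>The Jacobian times Euler's integrand is \<open>c * F t\<close>. With all powers
    written as exponentials of logarithms, this is a comparison of exponents.\<close>
  have sub: "\<bar>a * (real q * t ^ (q - 1))\<bar> *\<^sub>R G (a * t ^ q) = c * F t" if t: "t > 0" for t
  proof -
    have pow: "t ^ k = exp (real k * ln t)" for k
      using t by (metis exp_ln exp_of_nat_mult)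
    have "complex_of_real \<bar>a * (real q * t ^ (q - 1))\<bar>
        = of_nat q * exp (of_real (ln a)) * exp (of_real (real (q - 1) * ln t))"
      using t a unfolding exp_of_real by (simp add: abs_mult pow)
    moreover have "complex_of_real (a * t ^ q) powr (z - 1)
        = exp ((z - 1) * of_real (ln a + real q * ln t))"
      using t a by (subst of_real_powr_eq_exp) (auto simp: ln_mult ln_realpow)
    moreover have "exp (of_real (ln a)) * exp (complex_of_real (real (q - 1) * ln t))
         * exp ((z - 1) * of_real (ln a + real q * ln t))
         = exp (z * of_real (ln a)) * exp ((of_nat q * z - 1) * of_real (ln t))"
      unfolding exp_add[symmetric] using q by (simp add: of_nat_diff algebra_simps)
    moreover have "c * F t = of_nat q * (exp (z * of_real (ln a)) * exp ((of_nat q * z - 1) * of_real (ln t)))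
        * of_real (exp (- (a * t ^ q)))"
      using t a by (simp add: c_def F_def of_real_powr_eq_exp)
    ultimately show ?thesis
      by (simp only: scaleR_conv_of_real G_def)
         (simp add: mult_ac exp_minus divide_inverse)
  qed
  have G: "G absolutely_integrable_on {0<..}" "integral {0<..} G = Gamma z"
    using absolutely_integrable_Gamma_integral'[OF z] Gamma_integral_complex'[OF z]
    by (auto simp: G_def)
  have der: "((\<lambda>t. a * t ^ q) has_field_derivative a * (real q * t ^ (q - 1))) (at t within {0<..})" for t
    using q by (auto intro!: derivative_eq_intros)
  have 1: "(\<lambda>t. \<bar>a * (real q * t ^ (q - 1))\<bar> *\<^sub>R G (a * t ^ q)) absolutely_integrable_on {0<..}"
    using absolutely_integrable_change_of_variables_real[of "{0<..}" "\<lambda>t. a * t ^ q" _ G, OF _ der inj]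
      G unfolding img by simp
  have 2: "integral {0<..} (\<lambda>t. \<bar>a * (real q * t ^ (q - 1))\<bar> *\<^sub>R G (a * t ^ q)) = Gamma z"
    using has_absolute_integral_change_of_variables_real[of "{0<..}" "\<lambda>t. a * t ^ q" _ G "Gamma z", OF _ der inj]
      G unfolding img by simp
  have 3: "(\<lambda>t. c * F t) absolutely_integrable_on {0<..}"
    using 1 by (rule set_integrable_cong[THEN iffD1, rotated -1]) (use sub in auto)
  have F: "F absolutely_integrable_on {0<..}"
    using 3 c by simp
  have cont: "continuous_on {0<..} F"
    unfolding F_def by (intro continuous_intros)
  show "set_integrable lborel {0<..} F"
    using set_integrable_lborel_of_lebesgue(1)[OF F cont] by simp
  have "c * integral {0<..} F = integral {0<..} (\<lambda>t. c * F t)" by simp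
  also have "\<dots> = integral {0<..} (\<lambda>t. \<bar>a * (real q * t ^ (q - 1))\<bar> *\<^sub>R G (a * t ^ q))"
    by (rule integral_cong) (use sub in auto)
  finally have "integral {0<..} F = Gamma z / c" using 2 c by (simp add: field_simps)
  then show "(LBINT t:{0<..}. F t) = Gamma z / (of_nat q * of_real a powr z)"
    using set_integrable_lborel_of_lebesgue(2)[OF F cont] by (simp add: c_def)
qed

lemma exp_integral:
  assumes "c > 0"
  shows "set_integrable lborel {0<..} (\<lambda>x. complex_of_real (exp (- (x * c))))"
    and "(LBINT x:{0<..}. complex_of_real (exp (- (x * c)))) = 1 / of_real c"
proof -
  note * = Gamma_integral_power[of 1 c 1]
  have eq: "complex_of_real x powr (of_nat 1 * 1 - 1) * of_real (exp (- (c * x ^ 1)))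
      = complex_of_real (exp (- (x * c)))" if "x \<in> {0<..}" for x
    using that by (simp add: mult.commute)
  have "set_integrable lborel {0<..} (\<lambda>x. complex_of_real x powr (of_nat 1 * 1 - 1) * of_real (exp (- (c * x ^ 1))))"
    by (rule *(1)) (use assms in auto)
  then show "set_integrable lborel {0<..} (\<lambda>x. complex_of_real (exp (- (x * c))))"
    by (rule set_integrable_cong[THEN iffD1, rotated -1]) (simp_all add: mult.commute)
  have "(LBINT x:{0<..}. complex_of_real (exp (- (x * c))))
      = (LBINT x:{0<..}. complex_of_real x powr (of_nat 1 * 1 - 1) * of_real (exp (- (c * x ^ 1))))"
    by (rule set_lebesgue_integral_cong) (simp_all add: mult.commute)
  also have "\<dots> = Gamma 1 / (of_nat 1 * of_real c powr 1)"
    by (rule *(2)) (use assms in auto)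
  finally show "(LBINT x:{0<..}. complex_of_real (exp (- (x * c)))) = 1 / of_real c"
    using assms by simp
qed

text \<open>The norm is embedded back into \<open>complex\<close>, so that a norm integral becomes
  the same Gamma integral with the exponent replaced by its real part.\<close>

lemma norm_of_real_powr:
  "t > 0 \<Longrightarrow> complex_of_real (norm (complex_of_real t powr z)) = of_real t powr of_real (Re z)"
  by (simp add: of_real_powr_eq_exp exp_of_real flip: exp_of_real)

text \<open>By Fubini, from \<open>1 / (u\<^sup>2 + b\<^sup>2) = \<integral>\<^sub>0\<^sup>\<infinity> e\<^bsup>-x(u\<^sup>2 + b\<^sup>2)\<^esup> dx\<close>; two Gamma integrals and the reflection formula remain.\<close>

lemma stieltjes_kernel_integral:
  fixes b :: real and w :: complex
  assumes w: "0 < Re w" "Re w < 2" and b: "b > 0"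
  defines "F \<equiv> \<lambda>u. complex_of_real u powr (w - 1) / of_real (u\<^sup>2 + b\<^sup>2)"
  shows "set_integrable lborel {0<..} F"
    and "(LBINT u:{0<..}. F u) = of_real pi * of_real b powr (w - 2) / (2 * sin (of_real pi * w / 2))"
proof -
  \<comment> \<open>The indicator is built into \<open>P\<close> and \<open>H\<close>, which makes
    them Borel functions on the whole line and plane, as Fubini requires.\<close>
  define P where "P = (\<lambda>u. indicator {0<..} u *\<^sub>R complex_of_real u powr (w - 1))"
  have [measurable]: "P \<in> borel_measurable borel"
    unfolding P_def by (intro borel_measurable_continuous_on_indicator continuous_intros) auto
  define H where "H = (\<lambda>(x, u). indicator {0<..} x *\<^sub>R (P u * complex_of_real (exp (- (x * (u\<^sup>2 + b\<^sup>2))))))"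
  have [measurable]: "H \<in> borel_measurable (lborel \<Otimes>\<^sub>M lborel)"
    unfolding H_def by measurable
  define z where "z = w / 2"
  define r where "r = complex_of_real (Re z)"
  have z: "Re z > 0" "Re z < 1" "Re r > 0" "Re r < 1" using w by (auto simp: z_def r_def)
  have split: "exp (- (x * (u\<^sup>2 + b\<^sup>2))) = exp (- (x * u\<^sup>2)) * exp (- (x * b\<^sup>2))" for x u
    by (simp add: algebra_simps flip: exp_add)
  \<comment> \<open>For fixed \<open>x\<close> the integral in \<open>u\<close> is Gaussian; the
    exponent \<open>w - 1\<close> is \<open>2 * z - 1\<close> with \<open>z = w / 2\<close>.\<close>
  have Gq: "set_integrable lborel {0<..} (\<lambda>u. complex_of_real u powr (of_nat 2 * z - 1) * of_real (exp (- (x * u ^ 2))))"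
    "(LBINT u:{0<..}. complex_of_real u powr (of_nat 2 * z - 1) * of_real (exp (- (x * u ^ 2)))) = Gamma z / (2 * of_real x powr z)"
    if "x > 0" "Re z > 0" for x z
    using Gamma_integral_power[of z x 2] that by auto
  have H_u: "H (x, u) = of_real (exp (- (x * b\<^sup>2))) * (indicator {0<..} u *\<^sub>R (complex_of_real u powr (of_nat 2 * z - 1) * of_real (exp (- (x * u ^ 2)))))"
    if "x > 0" for x u
    using that by (simp add: H_def P_def split z_def mult_ac)
  have nH_u: "complex_of_real (norm (H (x, u))) = of_real (exp (- (x * b\<^sup>2))) * (indicator {0<..} u *\<^sub>R (complex_of_real u powr (of_nat 2 * r - 1) * of_real (exp (- (x * u ^ 2)))))"
    if "x > 0" for x u
    using that norm_of_real_powr[of u "of_nat 2 * z - 1"]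
    by (cases "u > 0") (auto simp: H_u norm_mult r_def)
  have intH: "integrable lborel (\<lambda>u. H (x, u))" if "x > 0" for x
    unfolding H_u[OF that]
    by (rule integrable_mult_right) (use Gq[OF that z(1)] in \<open>simp add: set_integrable_def\<close>)
  have IH: "(\<integral>u. H (x, u) \<partial>lborel) = of_real (exp (- (x * b\<^sup>2))) * (Gamma z / (2 * of_real x powr z))" if "x > 0" for x
    unfolding H_u[OF that] integral_mult_right_zero
    using Gq(2)[OF that z(1)] unfolding set_lebesgue_integral_def by simp
  have nIH: "complex_of_real (\<integral>u. norm (H (x, u)) \<partial>lborel) = of_real (exp (- (x * b\<^sup>2))) * (Gamma r / (2 * of_real x powr r))" if "x > 0" for x
    unfolding integral_complex_of_real[symmetric] nH_u[OF that] integral_mult_right_zero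
    using Gq(2)[OF that z(3)] unfolding set_lebesgue_integral_def by simp
  \<comment> \<open>What remains after the \<open>u\<close>-integral is x^(-z) e^(-b^2 x), the
    integrand of Gamma(1 - z). Its convergence at 0 needs \<open>Re z < 1\<close>, that is
    \<open>Re w < 2\<close>.\<close>
  have outer: "indicator {0<..} x *\<^sub>R (of_real (exp (- (x * b\<^sup>2))) * (Gamma z / (2 * of_real x powr z)))
     = Gamma z / 2 * (indicator {0<..} x *\<^sub>R (complex_of_real x powr (of_nat 1 * (1 - z) - 1) * of_real (exp (- (b\<^sup>2 * x ^ 1)))))" for x z
  proof (cases "x > 0")
    case True
    have "complex_of_real x powr (of_nat 1 * (1 - z) - 1) = 1 / of_real x powr z"
      by (simp add: powr_minus_divide)
    then show ?thesis using True by (simp add: mult.commute[of x])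
  qed simp
  have H0: "H (x, u) = 0" if "\<not> x > 0" for x u using that by (simp add: H_def)
  \<comment> \<open>Taking norms replaces \<open>z\<close> by \<open>r\<close> in the same
    computation, so the iterated norm integral is again a finite Gamma integral.\<close>
  have Hint: "integrable (lborel \<Otimes>\<^sub>M lborel) H"
  proof (rule lborel_pair.Fubini_integrable)
    let ?g = "\<lambda>x. indicator {0<..} x *\<^sub>R (complex_of_real x powr (of_nat 1 * (1 - r) - 1) * of_real (exp (- (b\<^sup>2 * x ^ 1))))"
    have eq: "complex_of_real (\<integral>u. norm (H (x, u)) \<partial>lborel) = Gamma r / 2 * ?g x" for x
      unfolding outer[symmetric] by (cases "x > 0") (simp_all add: nIH H0)
    have "integrable lborel ?g"
      using Gamma_integral_power(1)[of "1 - r" "b\<^sup>2" 1] z b unfolding set_integrable_def by simp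
    then have "integrable lborel (\<lambda>x. complex_of_real (\<integral>u. norm (H (x, u)) \<partial>lborel))"
      unfolding eq by (rule integrable_mult_right)
    then show "integrable lborel (\<lambda>x. \<integral>u. norm (H (x, u)) \<partial>lborel)"
      by (simp add: complex_of_real_integrable_eq)
    show "AE x in lborel. integrable lborel (\<lambda>u. H (x, u))"
      using intH H0 by (intro AE_I2) (metis (no_types, lifting) integrable_zero ext)
  qed measurable
  have Fu: "(\<integral>x. H (x, u) \<partial>lborel) = indicator {0<..} u *\<^sub>R F u" for u
  proof -
    have pos: "u\<^sup>2 + b\<^sup>2 > 0" using b by (simp add: add_nonneg_pos)
    have "(\<integral>x. H (x, u) \<partial>lborel) = (\<integral>x. P u * (indicator {0<..} x *\<^sub>R complex_of_real (exp (- (x * (u\<^sup>2 + b\<^sup>2))))) \<partial>lborel)"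
      by (simp add: H_def scaleR_conv_of_real mult_ac)
    also have "\<dots> = P u * (1 / of_real (u\<^sup>2 + b\<^sup>2))"
      unfolding integral_mult_right_zero
      using exp_integral(2)[OF pos] unfolding set_lebesgue_integral_def by simp
    finally show ?thesis by (cases "u > 0") (simp_all add: P_def F_def)
  qed
  have "integrable lborel (\<lambda>u. \<integral>x. H (x, u) \<partial>lborel)"
    using lborel_pair.integrable_snd[of "\<lambda>x u. H (x, u)"] Hint by simp
  then show "set_integrable lborel {0<..} F" by (simp add: set_integrable_def Fu)
  have "(LBINT u:{0<..}. F u) = (\<integral>u. (\<integral>x. H (x, u) \<partial>lborel) \<partial>lborel)"
    by (simp add: set_lebesgue_integral_def Fu)
  also have "\<dots> = (\<integral>x. (\<integral>u. H (x, u) \<partial>lborel) \<partial>lborel)"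
    using lborel_pair.Fubini_integral[of "\<lambda>x u. H (x, u)"] Hint by simp
  also have "\<dots> = (\<integral>x. Gamma z / 2 * (indicator {0<..} x *\<^sub>R (complex_of_real x powr (of_nat 1 * (1 - z) - 1) * of_real (exp (- (b\<^sup>2 * x ^ 1))))) \<partial>lborel)"
    unfolding outer[symmetric]
  proof (intro Bochner_Integration.integral_cong refl)
    show "(\<integral>u. H (x, u) \<partial>lborel) = indicator {0<..} x *\<^sub>R (of_real (exp (- (x * b\<^sup>2))) * (Gamma z / (2 * of_real x powr z)))" for x
      by (cases "x > 0") (simp_all add: IH H0)
  qed
  also have "\<dots> = Gamma z / 2 * (Gamma (1 - z) / (of_nat 1 * of_real (b\<^sup>2) powr (1 - z)))"
    unfolding integral_mult_right_zero
    using Gamma_integral_power(2)[of "1 - z" "b\<^sup>2" 1] z b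
    by (simp add: set_lebesgue_integral_def)
  also have "\<dots> = Gamma z * Gamma (1 - z) / (2 * of_real (b\<^sup>2) powr (1 - z))" by simp
  also have "Gamma z * Gamma (1 - z) = of_real pi / sin (of_real pi * w / 2)"
    by (simp add: Gamma_reflection_complex z_def times_divide_eq_right)
  also have "of_real pi / sin (of_real pi * w / 2) / (2 * of_real (b\<^sup>2) powr (1 - z))
     = of_real pi * of_real b powr (w - 2) / (2 * sin (of_real pi * w / 2))"
  \<comment> \<open>The two powers of \<open>b\<close> are inverse to each other because 2 (1 - z) =
    2 - w.\<close>
  proof -
    have "of_real (b\<^sup>2) powr (1 - z) * of_real b powr (w - 2)
        = exp ((1 - z) * of_real (2 * ln b) + (w - 2) * of_real (ln b))"
      using b by (subst (1 2) of_real_powr_eq_exp) (simp_all add: ln_realpow flip: exp_add)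
    also have "(1 - z) * of_real (2 * ln b) + (w - 2) * of_real (ln b) = 0"
      by (simp add: z_def algebra_simps)
    finally have "of_real b powr (w - 2) = inverse (complex_of_real (b\<^sup>2) powr (1 - z))"
      by (metis exp_zero inverse_unique)
    then show ?thesis by (simp only: divide_inverse inverse_mult_distrib mult_ac)
  qed
  finally show "(LBINT u:{0<..}. F u) = of_real pi * of_real b powr (w - 2) / (2 * sin (of_real pi * w / 2))" .
qed

section \<open>Partial fractions of the secant\<close>

text \<open>Differentiate both sides of the reflection formula Gamma(z) Gamma(1 - z) = pi / sin(pi
  z) and divide by the common value.\<close>

lemma Digamma_reflection:
  fixes z :: complex
  assumes "z \<notin> \<int>"
  shows "Digamma (1 - z) - Digamma z = of_real pi * cot (of_real pi * z)"
proof -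
  let ?s = "sin (of_real pi * z)" and ?G = "Gamma z * Gamma (1 - z)"
  have s0: "?s \<noteq> 0"
    using assms sin_eq_0[of "of_real pi * z"] by (auto simp: Ints_def)
  have "1 - z \<notin> \<int>" using assms Ints_diff[of 1 "1 - z"] by auto
  then have n: "z \<notin> \<int>\<^sub>\<le>\<^sub>0" "1 - z \<notin> \<int>\<^sub>\<le>\<^sub>0" using assms nonpos_Ints_Int by blast+
  have "((\<lambda>z. Gamma z * Gamma (1 - z)) has_field_derivative ?G * (Digamma z - Digamma (1 - z))) (at z)"
    using n by (auto intro!: derivative_eq_intros simp: algebra_simps)
  moreover have "((\<lambda>z. of_real pi / sin (of_real pi * z)) has_field_derivative
      - (of_real pi)\<^sup>2 * cos (of_real pi * z) / ?s\<^sup>2) (at z)"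
    using s0 by (auto intro!: derivative_eq_intros simp: power2_eq_square)
  ultimately have eq: "of_real pi / ?s * (Digamma z - Digamma (1 - z)) = - (of_real pi)\<^sup>2 * cos (of_real pi * z) / ?s\<^sup>2"
    unfolding Gamma_reflection_complex by (rule DERIV_unique)
  have "Digamma z - Digamma (1 - z) = ?s / of_real pi * (of_real pi / ?s * (Digamma z - Digamma (1 - z)))"
    using s0 by simp
  also have "\<dots> = - (of_real pi * cot (of_real pi * z))"
    unfolding eq using s0 by (simp add: cot_def power2_eq_square)
  finally have "- (Digamma z - Digamma (1 - z)) = - (- (of_real pi * cot (of_real pi * z)))"
    by (rule arg_cong)
  then show ?thesis by simp
qed

text \<open>Even and odd indices give two instances of the limit formula for \<open>Digamma\<close>,
  at \<open>a / 2\<close> and \<open>(a + 1) / 2\<close>. With \<open>2*n\<close> terms both have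
  the same length, so their logarithms cancel.\<close>

lemma alternating_harmonic_sums:
  fixes a :: complex
  assumes "a \<notin> \<int>"
  shows "(\<lambda>n. (\<Sum>k<2*n. (-1) ^ k / (of_nat k + a)))
     \<longlonglongrightarrow> (Digamma ((a + 1) / 2) - Digamma (a / 2)) / 2"
proof -
  have nz: "a / 2 \<noteq> 0" "(a + 1) / 2 \<noteq> 0"
    using assms by (auto simp: add_eq_0_iff2)
  have kz: "of_nat k + a \<noteq> 0" for k
    using assms by (metis Ints_minus Ints_of_nat add_eq_0_iff)
  have "(\<lambda>m. (of_real (ln (real m)) - (\<Sum>n<m. inverse (a / 2 + of_nat n)))
      - (of_real (ln (real m)) - (\<Sum>n<m. inverse ((a + 1) / 2 + of_nat n))))
      \<longlonglongrightarrow> Digamma (a / 2) - Digamma ((a + 1) / 2)"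
    by (intro tendsto_diff Digamma_LIMSEQ nz)
  then have "(\<lambda>m. - (1 / 2) * ((of_real (ln (real m)) - (\<Sum>n<m. inverse (a / 2 + of_nat n)))
      - (of_real (ln (real m)) - (\<Sum>n<m. inverse ((a + 1) / 2 + of_nat n)))))
      \<longlonglongrightarrow> - (1 / 2) * (Digamma (a / 2) - Digamma ((a + 1) / 2))"
    by (intro tendsto_mult_left)
  moreover have "- (1 / 2) * ((of_real (ln (real m)) - (\<Sum>n<m. inverse (a / 2 + of_nat n)))
      - (of_real (ln (real m)) - (\<Sum>n<m. inverse ((a + 1) / 2 + of_nat n))))
      = (\<Sum>k<2*m. (-1) ^ k / (of_nat k + a))" for m
  proof (induction m)
    case (Suc m)
    have "2 * of_nat m + a \<noteq> 0" "2 * of_nat m + 1 + a \<noteq> 0"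
      using kz[of "2*m"] kz[of "2*m+1"] by (auto simp: add_ac)
    moreover have "a / 2 + of_nat m = (2 * of_nat m + a) / 2"
      "(a + 1) / 2 + of_nat m = (2 * of_nat m + 1 + a) / 2"
      by (simp_all add: field_simps)
    ultimately have "inverse (a / 2 + of_nat m) / 2 = 1 / (2 * of_nat m + a)"
       "inverse ((a + 1) / 2 + of_nat m) / 2 = 1 / (2 * of_nat m + 1 + a)"
      by (simp_all add: inverse_eq_divide)
    with Suc show ?case
      by (simp add: algebra_simps)
  qed simp
  ultimately have "(\<lambda>n. (\<Sum>k<2*n. (-1) ^ k / (of_nat k + a)))
      \<longlonglongrightarrow> - (1 / 2) * (Digamma (a / 2) - Digamma ((a + 1) / 2))"
    by (simp only:)
  then show ?thesis by (simp add: algebra_simps diff_divide_distrib)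
qed

text \<open>With a = 1/2 - x and b = 1/2 + x each term splits into (-1)^k / (k + a) + (-1)^k / (k +
  b). Since (a + 1)/2 = 1 - b/2 and (b + 1)/2 = 1 - a/2, the four Digamma values regroup into two
  reflections, hence into a sum of two cotangents.\<close>

lemma sec_partial_fractions:
  fixes x :: complex
  assumes "cos (of_real pi * x) \<noteq> 0"
  shows "(\<lambda>n. \<Sum>k<2*n. (-1) ^ k * (2 * (of_nat k + 1/2)) / ((of_nat k + 1/2)\<^sup>2 - x\<^sup>2))
    \<longlonglongrightarrow> of_real pi / cos (of_real pi * x)"
proof -
  \<comment> \<open>Neither \<open>a\<close> nor \<open>b\<close> is an integer, because sin(pi (1/2
    + x)) and sin(pi (1/2 - x)) both equal cos(pi x).\<close>
  have ni: "1/2 + c * x \<notin> \<int>" if "c = 1 \<or> c = -1" for c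
  proof
    assume "1/2 + c * x \<in> \<int>"
    then obtain i where i: "1/2 + c * x = of_int i" by (auto elim: Ints_cases)
    have "sin (of_real pi * (1/2 + c * x)) = 0" unfolding i by (simp add: mult.commute sin_eq_0)
    moreover have "of_real pi * (1/2 + c * x) = of_real pi / 2 + c * (of_real pi * x)"
      by (simp add: algebra_simps)
    ultimately show False using assms that by (auto simp: sin_add sin_of_real_pi_half cos_of_real_pi_half)
  qed
  have ni2: "y / 2 \<notin> \<int>" if "y \<notin> \<int>" for y :: complex
    using that Ints_mult[of "y/2" 2] by auto
  define a where "a = 1/2 - x"
  define b where "b = 1/2 + x"
  have ab: "a \<notin> \<int>" "b \<notin> \<int>" using ni[of "-1"] ni[of 1] by (auto simp: a_def b_def)
  have kz: "of_nat k + y \<noteq> 0" if "y \<notin> \<int>" for k and y :: complex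
    using that by (metis Ints_minus Ints_of_nat add_eq_0_iff)
  have "(\<lambda>n. (\<Sum>k<2*n. (-1) ^ k / (of_nat k + a)) + (\<Sum>k<2*n. (-1) ^ k / (of_nat k + b)))
     \<longlonglongrightarrow> (Digamma ((a + 1) / 2) - Digamma (a / 2)) / 2 + (Digamma ((b + 1) / 2) - Digamma (b / 2)) / 2"
    by (intro tendsto_add alternating_harmonic_sums ab)
  also have "(\<lambda>n. (\<Sum>k<2*n. (-1) ^ k / (of_nat k + a)) + (\<Sum>k<2*n. (-1) ^ k / (of_nat k + b)))
    = (\<lambda>n. \<Sum>k<2*n. (-1) ^ k * (2 * (of_nat k + 1/2)) / ((of_nat k + 1/2)\<^sup>2 - x\<^sup>2))"
  proof (rule ext, unfold sum.distrib[symmetric], rule sum.cong[OF refl])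
    fix n k
    have f: "(of_nat k + 1/2)\<^sup>2 - x\<^sup>2 = (of_nat k + a) * (of_nat k + b)"
      by (simp add: a_def b_def power2_eq_square algebra_simps)
    have g: "2 * (of_nat k + 1/2) = (of_nat k + a) + (of_nat k + b)"
      by (simp add: a_def b_def)
    show "(-1) ^ k / (of_nat k + a) + (-1) ^ k / (of_nat k + b)
      = (-1) ^ k * (2 * (of_nat k + 1/2)) / ((of_nat k + 1/2)\<^sup>2 - x\<^sup>2)"
      unfolding f g using kz[OF ab(1), of k] kz[OF ab(2), of k] by (simp add: field_simps)
  qed
  also have "(Digamma ((a + 1) / 2) - Digamma (a / 2)) / 2 + (Digamma ((b + 1) / 2) - Digamma (b / 2)) / 2
     = ((Digamma (1 - b / 2) - Digamma (b / 2)) + (Digamma (1 - a / 2) - Digamma (a / 2))) / 2"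
  proof -
    have "(a + 1) / 2 = 1 - b / 2" "(b + 1) / 2 = 1 - a / 2"
      by (simp_all add: a_def b_def field_simps)
    then show ?thesis by (simp add: diff_divide_distrib add_divide_distrib)
  qed
  also have "\<dots> = of_real pi / 2 * (cot (of_real pi * (b / 2)) + cot (of_real pi * (a / 2)))"
    unfolding Digamma_reflection[OF ni2[OF ab(1)]] Digamma_reflection[OF ni2[OF ab(2)]]
    by (simp add: algebra_simps)
  also have "\<dots> = of_real pi / cos (of_real pi * x)"
  proof -
    define A where "A = of_real pi * (a / 2)"
    define B where "B = of_real pi * (b / 2)"
    have s: "sin A \<noteq> 0" "sin B \<noteq> 0"
      using ni2[OF ab(1)] ni2[OF ab(2)] by (auto simp: A_def B_def sin_eq_0 Ints_def)
    \<comment> \<open>As A + B = pi/2, the numerator sin(A + B) of cot A + cot B is 1, and cos(A +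
      B) = 0 turns the denominator sin A sin B into cos(B - A) / 2.\<close>
    have "A + B = of_real (pi / 2)" by (simp add: A_def B_def a_def b_def field_simps)
    then have 1: "sin (A + B) = 1" "cos (A + B) = 0"
      by (simp_all only: sin_of_real cos_of_real sin_pi_half cos_pi_half of_real_0 of_real_1)
    have "B - A = of_real pi * x" by (simp add: A_def B_def a_def b_def field_simps)
    then have 2: "cos (of_real pi * x) = cos (B - A)" by simp
    have 3: "cos (B - A) = 2 * (sin A * sin B)" using 1(2) by (simp add: cos_add cos_diff algebra_simps)
    have "cot B + cot A = sin (A + B) / (sin A * sin B)"
      using s by (simp add: cot_def sin_add field_simps)
    then show ?thesis unfolding A_def[symmetric] B_def[symmetric] 2 3 1(1) using s by simp
  qed
  finally show ?thesis .
qed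

section \<open>The hyperbolic secant and its partial fraction expansion\<close>

definition sech_half :: "real \<Rightarrow> real" where
  "sech_half t = exp (t / 2) / (exp t + 1)"

text \<open>The poles of \<open>sech_half\<close> are the points i * \<open>odd_pi n\<close> and
  their negatives.\<close>

definition odd_pi :: "nat \<Rightarrow> real" where
  "odd_pi n = 2 * pi * (real n + 1 / 2)"

lemma odd_pi_pos: "odd_pi n > 0"
  by (simp add: odd_pi_def add_nonneg_pos)

lemma sech_half_eq_cosh: "sech_half t = 1 / (2 * cosh (t / 2))"
proof -
  have "exp t = exp (t / 2) * exp (t / 2)" by (simp flip: exp_add)
  moreover have "2 + 2 * (exp (t / 2) * exp (t / 2)) \<noteq> 0" "1 + exp (t / 2) * exp (t / 2) \<noteq> 0"
    by (smt (verit) mult_pos_pos exp_gt_zero)+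
  ultimately show ?thesis by (simp add: sech_half_def cosh_field_def exp_minus field_simps)
qed

lemma continuous_on_sech_half [continuous_intros]: "continuous_on A sech_half"
proof -
  have "exp t + 1 \<noteq> 0" for t :: real using exp_gt_zero[of t] by linarith
  then show ?thesis unfolding sech_half_def by (intro continuous_intros) auto
qed

text \<open>Rescaling by x = v / (2 pi). Complex \<open>v\<close> covers both uses: v = i t gives
  the expansion of \<open>sech_half\<close>, and real v = 2 y produces the term 1 / cos y in
  \<open>sech_stieltjes_eq\<close>.\<close>

lemma sec_partial_fractions_odd_pi:
  fixes v :: complex
  assumes "cos (v / 2) \<noteq> 0"
  shows "(\<lambda>n. \<Sum>k<2*n. (-1) ^ k * (2 * of_real (odd_pi k)) / ((of_real (odd_pi k))\<^sup>2 - v\<^sup>2))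
    \<longlonglongrightarrow> 1 / (2 * cos (v / 2))"
proof -
  have v: "complex_of_real pi * (v / (2 * of_real pi)) = v / 2" by simp
  have "(\<lambda>n. 1 / (2 * of_real pi) * (\<Sum>k<2*n. (-1) ^ k * (2 * (of_nat k + 1/2)) / ((of_nat k + 1/2)\<^sup>2 - (v / (2 * of_real pi))\<^sup>2)))
    \<longlonglongrightarrow> 1 / (2 * of_real pi) * (of_real pi / cos (of_real pi * (v / (2 * of_real pi))))"
    by (intro tendsto_mult_left sec_partial_fractions) (use assms in \<open>unfold v\<close>)
  moreover have "1 / (2 * complex_of_real pi) * ((-1) ^ k * (2 * (of_nat k + 1/2)) / ((of_nat k + 1/2)\<^sup>2 - (v / (2 * of_real pi))\<^sup>2))
     = (-1) ^ k * (2 * of_real (odd_pi k)) / ((of_real (odd_pi k))\<^sup>2 - v\<^sup>2)" for k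
  proof -
    have "(of_nat k + 1/2)\<^sup>2 - (v / (2 * complex_of_real pi))\<^sup>2
      = ((of_real (odd_pi k))\<^sup>2 - v\<^sup>2) / (2 * of_real pi)\<^sup>2"
      by (simp add: odd_pi_def power_divide power_mult_distrib diff_divide_distrib)
    then show ?thesis by (simp add: odd_pi_def power2_eq_square)
  qed
  ultimately show ?thesis unfolding v sum_distrib_left by simp
qed

lemma sech_half_partial_fractions:
  "(\<lambda>n. \<Sum>k<2*n. (-1) ^ k * (2 * odd_pi k) / (t\<^sup>2 + (odd_pi k)\<^sup>2)) \<longlonglongrightarrow> sech_half t"
proof -
  have "\<i> * complex_of_real t / 2 = \<i> * complex_of_real (t / 2)" by simp
  moreover have "cosh (complex_of_real x) = of_real (cosh x)" for x
    by (simp add: cosh_field_def exp_of_real flip: of_real_minus)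
  ultimately have c: "cos (\<i> * complex_of_real t / 2) = of_real (cosh (t / 2))"
    by (simp only: cosh_conv_cos[symmetric])
  have "(\<lambda>n. complex_of_real (\<Sum>k<2*n. (-1) ^ k * (2 * odd_pi k) / (t\<^sup>2 + (odd_pi k)\<^sup>2))) \<longlonglongrightarrow> of_real (sech_half t)"
    using sec_partial_fractions_odd_pi[of "\<i> * complex_of_real t"]
    by (simp add: c sech_half_eq_cosh power_mult_distrib add.commute)
  then show ?thesis by (simp only: tendsto_of_real_iff)
qed

lemma sum_alternating_pairs:
  fixes a :: "nat \<Rightarrow> 'a :: comm_ring_1"
  shows "(\<Sum>k<2*n. (-1) ^ k * a k) = (\<Sum>k<n. a (2 * k) - a (Suc (2 * k)))"
  by (induction n) simp_all

text \<open>This provides the majorant for integrating the expansion term by term. Single terms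
  decay only like 1/k, but the difference of two neighbours is O(1/k^2) uniformly in
  \<open>t\<close>.\<close>

lemma sech_half_partial_sums_bounded:
  obtains C where "C \<ge> 0"
    and "\<And>n t. \<bar>\<Sum>k<2*n. (-1) ^ k * (2 * odd_pi k) / (t\<^sup>2 + (odd_pi k)\<^sup>2)\<bar> \<le> C"
proof
  let ?a = "\<lambda>k t. 2 * odd_pi k / (t\<^sup>2 + (odd_pi k)\<^sup>2)"
  let ?M = "\<lambda>k. 2 * inverse (real (Suc k) ^ 2)"
  have M: "summable ?M"
    by (intro summable_mult) (subst summable_Suc_iff, rule inverse_power_summable, simp)
  have pair: "\<bar>?a (2 * k) t - ?a (Suc (2 * k)) t\<bar> \<le> ?M k" for k t
  proof -
    define b where "b = odd_pi (2 * k)"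
    define c where "c = odd_pi (Suc (2 * k))"
    have b: "b > 0" "c = b + 2 * pi"
      by (auto simp: b_def c_def odd_pi_pos) (auto simp: odd_pi_def algebra_simps)
    have c: "c > 0" "c \<ge> b" using b by (auto simp: add_pos_pos)
    have pos: "t\<^sup>2 + b\<^sup>2 > 0" "t\<^sup>2 + c\<^sup>2 > 0" using b(1) c(1) by (intro add_nonneg_pos zero_less_power; simp)+
    have "?a (2 * k) t - ?a (Suc (2 * k)) t = 4 * pi * (b * c - t\<^sup>2) / ((t\<^sup>2 + b\<^sup>2) * (t\<^sup>2 + c\<^sup>2))"
    proof -
      have "2 * b / (t\<^sup>2 + b\<^sup>2) - 2 * c / (t\<^sup>2 + c\<^sup>2)
          = (2 * b * (t\<^sup>2 + c\<^sup>2) - 2 * c * (t\<^sup>2 + b\<^sup>2)) / ((t\<^sup>2 + b\<^sup>2) * (t\<^sup>2 + c\<^sup>2))"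
        using pos by (intro diff_frac_eq) auto
      also have "2 * b * (t\<^sup>2 + c\<^sup>2) - 2 * c * (t\<^sup>2 + b\<^sup>2) = 2 * (c - b) * (b * c - t\<^sup>2)"
        by (simp add: algebra_simps power2_eq_square)
      finally show ?thesis by (simp add: b_def[symmetric] c_def[symmetric] b(2))
    qed
    also have "\<bar>\<dots>\<bar> = 4 * pi * \<bar>b * c - t\<^sup>2\<bar> / ((t\<^sup>2 + b\<^sup>2) * (t\<^sup>2 + c\<^sup>2))"
      using pos by (simp add: abs_mult)
    \<comment> \<open>The numerator is estimated by the factor t^2 + c^2 of the denominator, which
      then cancels and leaves a bound without \<open>c\<close>.\<close>
    also have "\<dots> \<le> 4 * pi * (t\<^sup>2 + c\<^sup>2) / ((t\<^sup>2 + b\<^sup>2) * (t\<^sup>2 + c\<^sup>2))"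
    proof (intro divide_right_mono mult_left_mono)
      have "b * c \<le> c * c" "0 \<le> b * c" using b c by (auto intro: mult_right_mono)
      then show "\<bar>b * c - t\<^sup>2\<bar> \<le> t\<^sup>2 + c\<^sup>2"
        using zero_le_power2[of t] unfolding power2_eq_square[of c] by linarith
    qed (use pos in auto)
    also have "\<dots> = 4 * pi / (t\<^sup>2 + b\<^sup>2)" using pos(2) by (intro nonzero_mult_divide_mult_cancel_right) auto
    also have "\<dots> \<le> 4 * pi / (pi\<^sup>2 * (real (Suc k))\<^sup>2)"
    proof (intro divide_left_mono)
      have "pi * real (Suc k) \<le> b" by (simp add: b_def odd_pi_def algebra_simps)
      then have "(pi * real (Suc k))\<^sup>2 \<le> b\<^sup>2" by (intro power_mono) auto
      then show "pi\<^sup>2 * (real (Suc k))\<^sup>2 \<le> t\<^sup>2 + b\<^sup>2"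
        unfolding power_mult_distrib by (simp add: add_increasing)
    qed (use pos in auto)
    also have "\<dots> = 4 / pi * inverse (real (Suc k) ^ 2)" by (simp add: divide_simps power2_eq_square del: of_nat_Suc)
    also have "\<dots> \<le> ?M k"
      using pi_gt3 by (intro mult_right_mono) (auto simp: field_simps)
    finally show ?thesis .
  qed
  show "0 \<le> suminf ?M" by (rule suminf_nonneg[OF M]) simp
  fix n t
  have "(\<Sum>k<2*n. (-1) ^ k * (2 * odd_pi k) / (t\<^sup>2 + (odd_pi k)\<^sup>2)) = (\<Sum>k<n. ?a (2 * k) t - ?a (Suc (2 * k)) t)"
    using sum_alternating_pairs[of "\<lambda>k. ?a k t" n] by (simp only: times_divide_eq_right)
  moreover have "\<bar>\<Sum>k<n. ?a (2 * k) t - ?a (Suc (2 * k)) t\<bar> \<le> (\<Sum>k<n. ?M k)"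
    by (rule order.trans[OF sum_abs]) (intro sum_mono pair)
  moreover have "(\<Sum>k<n. ?M k) \<le> suminf ?M"
    by (rule sum_le_suminf[OF M]) auto
  ultimately show "\<bar>\<Sum>k<2*n. (-1) ^ k * (2 * odd_pi k) / (t\<^sup>2 + (odd_pi k)\<^sup>2)\<bar> \<le> suminf ?M"
    by (simp only:)
qed

text \<open>Partial fractions in u^2 write the integrand as the difference of the kernels for
  \<open>b\<close> and \<open>c\<close> over c^2 - b^2, which is nonzero for distinct positive
  \<open>b\<close> and \<open>c\<close>.\<close>

lemma stieltjes_kernel_product_integral:
  fixes b c :: real and w :: complex
  assumes w: "0 < Re w" "Re w < 2" and b: "b > 0" and c: "c > 0" and bc: "b \<noteq> c"
  defines "F \<equiv> \<lambda>u. complex_of_real u powr (w - 1) / of_real (u\<^sup>2 + c\<^sup>2) / of_real (u\<^sup>2 + b\<^sup>2)"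
  shows "set_integrable lborel {0<..} F"
    and "(LBINT u:{0<..}. F u) = of_real pi / (2 * sin (of_real pi * w / 2)) *
           ((of_real b powr (w - 2) - of_real c powr (w - 2)) / of_real (c\<^sup>2 - b\<^sup>2))"
proof -
  let ?k = "\<lambda>b u. complex_of_real u powr (w - 1) / of_real (u\<^sup>2 + b\<^sup>2)"
  have ne: "c\<^sup>2 - b\<^sup>2 \<noteq> 0" using b c bc by (simp add: power2_eq_iff)
  have F: "F u = (?k b u - ?k c u) / of_real (c\<^sup>2 - b\<^sup>2)" for u
  proof -
    have p: "u\<^sup>2 + b\<^sup>2 \<noteq> 0" "u\<^sup>2 + c\<^sup>2 \<noteq> 0" using b c by (auto simp: add_nonneg_eq_0_iff)
    have "1 / (u\<^sup>2 + c\<^sup>2) / (u\<^sup>2 + b\<^sup>2) = (1 / (u\<^sup>2 + b\<^sup>2) - 1 / (u\<^sup>2 + c\<^sup>2)) / (c\<^sup>2 - b\<^sup>2)"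
      using p ne by (simp add: divide_simps)
    then have "complex_of_real (1 / (u\<^sup>2 + c\<^sup>2) / (u\<^sup>2 + b\<^sup>2)) = of_real ((1 / (u\<^sup>2 + b\<^sup>2) - 1 / (u\<^sup>2 + c\<^sup>2)) / (c\<^sup>2 - b\<^sup>2))"
      by (rule arg_cong)
    moreover have "F u = complex_of_real u powr (w - 1) * complex_of_real (1 / (u\<^sup>2 + c\<^sup>2) / (u\<^sup>2 + b\<^sup>2))"
      by (simp add: F_def)
    ultimately show ?thesis
      by (simp only: of_real_divide of_real_diff of_real_1)
         (simp add: right_diff_distrib)
  qed
  have I: "set_integrable lborel {0<..} (?k b)" "set_integrable lborel {0<..} (?k c)"
    using stieltjes_kernel_integral(1)[OF w] b c by auto
  then show "set_integrable lborel {0<..} F" unfolding F by (intro set_integrable_divide set_integral_diff)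
  show "(LBINT u:{0<..}. F u) = of_real pi / (2 * sin (of_real pi * w / 2)) *
           ((of_real b powr (w - 2) - of_real c powr (w - 2)) / of_real (c\<^sup>2 - b\<^sup>2))"
    unfolding F set_integral_divide_zero set_integral_diff(2)[OF I] stieltjes_kernel_integral(2)[OF w b] stieltjes_kernel_integral(2)[OF w c]
    by (simp only: divide_inverse left_diff_distrib right_diff_distrib mult_ac)
qed

section \<open>The Mellin and Stieltjes transforms of the hyperbolic secant\<close>

lemma of_real_powr_mult:
  assumes "a > 0" "b > 0"
  shows "complex_of_real (a * b) powr z = of_real a powr z * of_real b powr z"
  using assms by (subst (1 2 3) of_real_powr_eq_exp) (auto simp: ln_mult algebra_simps simp flip: exp_add)

lemma set_borel_measurable_continuous:
  fixes f :: "real \<Rightarrow> 'a :: real_normed_vector"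
  assumes "A \<in> sets borel" "continuous_on A f"
  shows "set_borel_measurable lborel A f"
  using borel_measurable_continuous_on_indicator[OF assms] by (simp add: set_borel_measurable_def)

text \<open>Dominated convergence with majorant \<open>C\<close> times the norm of \<open>G\<close>.
  It is applied to the geometric series (Mellin transform) and to the partial fractions (Stieltjes
  transform).\<close>

lemma dominated_product_integral:
  fixes G :: "real \<Rightarrow> complex" and S :: "nat \<Rightarrow> real \<Rightarrow> real"
  assumes A: "A \<in> sets borel"
    and G: "set_integrable lborel A G"
    and S: "\<And>n. continuous_on A (S n)"
    and h: "continuous_on A h"
    and bound: "\<And>n t. t \<in> A \<Longrightarrow> \<bar>S n t\<bar> \<le> C"
    and lim: "\<And>t. t \<in> A \<Longrightarrow> (\<lambda>n. S n t) \<longlonglongrightarrow> h t"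
  shows "set_integrable lborel A (\<lambda>t. G t * of_real (h t))"
    and "(\<lambda>n. LBINT t:A. G t * of_real (S n t)) \<longlonglongrightarrow> (LBINT t:A. G t * of_real (h t))"
proof -
  let ?f = "\<lambda>t. indicator A t *\<^sub>R (G t * complex_of_real (h t))"
  let ?s = "\<lambda>n t. indicator A t *\<^sub>R (G t * complex_of_real (S n t))"
  let ?w = "\<lambda>t. C * norm (indicator A t *\<^sub>R G t)"
  \<comment> \<open>Giving each factor its own indicator makes both measurable on the whole
    line.\<close>
  have split: "indicator A t *\<^sub>R (G t * complex_of_real (u t))
      = (indicator A t *\<^sub>R G t) * complex_of_real (indicator A t *\<^sub>R u t)" for u t
    by (cases "t \<in> A") auto
  have Gm [measurable]: "(\<lambda>t. indicator A t *\<^sub>R G t) \<in> borel_measurable lborel"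
    using G unfolding set_integrable_def by (rule borel_measurable_integrable)
  have m: "(\<lambda>t. indicator A t *\<^sub>R (G t * complex_of_real (u t))) \<in> borel_measurable lborel"
    if u: "continuous_on A u" for u
  proof -
    have [measurable]: "(\<lambda>t. indicator A t *\<^sub>R u t) \<in> borel_measurable lborel"
      using borel_measurable_continuous_on_indicator[OF A u] by simp
    show ?thesis unfolding split by measurable
  qed
  have w: "integrable lborel ?w"
    using G unfolding set_integrable_def by (intro integrable_mult_right integrable_norm)
  have lim': "AE t in lborel. (\<lambda>n. ?s n t) \<longlonglongrightarrow> ?f t"
  proof (rule AE_I2)
    show "(\<lambda>n. ?s n t) \<longlonglongrightarrow> ?f t" for t
      by (cases "t \<in> A") (auto intro!: tendsto_intros lim)
  qed
  have bound': "AE t in lborel. norm (?s n t) \<le> ?w t" for n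
  proof (rule AE_I2)
    show "norm (?s n t) \<le> ?w t" for t
      using bound[of t n]
      by (cases "t \<in> A") (auto simp: norm_mult mult.commute[of C] intro: mult_left_mono)
  qed
  have "integrable lborel ?f" "(\<lambda>n. integral\<^sup>L lborel (?s n)) \<longlonglongrightarrow> integral\<^sup>L lborel ?f"
    by (rule integrable_dominated_convergence[OF m[OF h] m[OF S] w lim' bound'])
       (rule integral_dominated_convergence[OF m[OF h] m[OF S] w lim' bound'])
  then show "set_integrable lborel A (\<lambda>t. G t * of_real (h t))"
    and "(\<lambda>n. LBINT t:A. G t * of_real (S n t)) \<longlonglongrightarrow> (LBINT t:A. G t * of_real (h t))"
    by (simp_all add: set_integrable_def set_lebesgue_integral_def)
qed

lemma set_integral_sum:
  fixes f :: "'i \<Rightarrow> 'a \<Rightarrow> 'b :: {banach, second_countable_topology}"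
  assumes "\<And>i. i \<in> I \<Longrightarrow> set_integrable M A (f i)"
  shows "(LINT x:A|M. (\<Sum>i\<in>I. f i x)) = (\<Sum>i\<in>I. LINT x:A|M. f i x)"
  using assms unfolding set_lebesgue_integral_def set_integrable_def
  by (simp add: scaleR_sum_right)

text \<open>This is K(z) of the overview.\<close>

definition sech_mellin :: "complex \<Rightarrow> complex" where
  "sech_mellin z = (LBINT t:{0<..}. of_real t powr (z - 1) * of_real (sech_half t))"

text \<open>Write \<open>sech_half t\<close> as e^(-t/2) / (1 + e^(-t)) and expand in powers of
  -e^(-t). The partial sums are bounded by 2, so they may be integrated in natural order even for
  \<open>Re z <= 1\<close>, where the Dirichlet series converges only conditionally.\<close>

lemma
  assumes z: "Re z > 0"
  shows sech_mellin_integrable: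
    "set_integrable lborel {0<..} (\<lambda>t. complex_of_real t powr (z - 1) * of_real (sech_half t))"
    and sech_mellin_sums:
    "(\<lambda>n. (-1) ^ n * of_nat (2 * n + 1) powr (- z)) sums (sech_mellin z / (2 powr z * Gamma z))"
proof -
  define G where "G = (\<lambda>t. complex_of_real t powr (z - 1) * of_real (exp (- (1 / 2 * t))))"
  define S where "S = (\<lambda>n (t::real). \<Sum>k<n. (- exp (- t)) ^ k)"
  define h where "h = (\<lambda>t::real. 1 / (1 + exp (- t)))"
  have ne: "1 + exp (- t) > 0" for t :: real by (simp add: add_pos_pos)
  have ne': "1 + exp (- t) \<noteq> 0" for t :: real using ne[of t] by linarith
  have pow: "(- exp (- t)) ^ k = (- 1) ^ k * exp (- (real k * t))" for k and t :: real
    by (subst power_minus) (simp flip: exp_of_nat_mult)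
  have Sg: "S n t = (1 - (- exp (- t)) ^ n) * h t" for n and t :: real
    using ne'[of t] sum_gp_strict[of "- exp (- t)" n] by (auto simp: S_def h_def)
  have I: "set_integrable lborel {0<..} (\<lambda>t. complex_of_real t powr (z - 1) * of_real (exp (- ((real k + 1 / 2) * t))))"
    "(LBINT t:{0<..}. complex_of_real t powr (z - 1) * of_real (exp (- ((real k + 1 / 2) * t)))) = Gamma z / of_real (real k + 1 / 2) powr z" for k
    using Gamma_integral_power[of z "real k + 1 / 2" 1] z by (simp_all add: add_nonneg_pos)
  have G: "set_integrable lborel {0<..} G" using I(1)[of 0] by (simp add: G_def)
  have lim: "(\<lambda>n. S n t) \<longlonglongrightarrow> h t" if "t \<in> {0<..}" for t :: real
  proof -
    have "(\<lambda>n. (1 - (- exp (- t)) ^ n) * h t) \<longlonglongrightarrow> (1 - 0) * h t"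
      using that by (intro tendsto_intros LIMSEQ_power_zero) auto
    then show ?thesis by (simp add: Sg)
  qed
  have bound: "\<bar>S n t\<bar> \<le> 2" if "t \<in> {0<..}" for n and t :: real
  proof -
    have "\<bar>(- exp (- t)) ^ n\<bar> \<le> 1" using that by (simp add: power_abs power_le_one)
    then have "\<bar>1 - (- exp (- t)) ^ n\<bar> \<le> 2" by linarith
    moreover have "\<bar>h t\<bar> \<le> 1" using ne[of t] by (simp add: h_def)
    ultimately have "\<bar>1 - (- exp (- t)) ^ n\<bar> * \<bar>h t\<bar> \<le> 2 * 1" by (intro mult_mono) auto
    then show ?thesis by (simp add: Sg abs_mult)
  qed
  have cont: "continuous_on {0<..} (S n)" "continuous_on {0<..} h" for n
    unfolding S_def h_def using ne' by (auto intro!: continuous_intros)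
  have Gh: "G t * of_real (h t) = complex_of_real t powr (z - 1) * of_real (sech_half t)" for t
  proof -
    have "exp t = exp (t / 2) * exp (t / 2)" by (simp flip: exp_add)
    then have "exp (- (1 / 2 * t)) * h t = sech_half t"
      using ne'[of t] by (simp add: h_def sech_half_def exp_minus divide_simps)
    then show ?thesis by (simp add: G_def mult.assoc flip: of_real_mult)
  qed
  note D = dominated_product_integral[OF _ G cont bound lim, unfolded Gh]
  show "set_integrable lborel {0<..} (\<lambda>t. complex_of_real t powr (z - 1) * of_real (sech_half t))"
    using D(1) by simp
  have partial: "(LBINT t:{0<..}. G t * of_real (S n t))
      = 2 powr z * Gamma z * (\<Sum>k<n. (-1) ^ k * of_nat (2 * k + 1) powr (- z))" for n
  proof -
    have "G t * of_real (S n t)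
      = (\<Sum>k<n. (-1) ^ k * (complex_of_real t powr (z - 1) * of_real (exp (- ((real k + 1 / 2) * t)))))" for t
    proof -
      have "G t * of_real (S n t) = (\<Sum>k<n. (-1) ^ k * (complex_of_real t powr (z - 1)
           * of_real (exp (- (1 / 2 * t)) * exp (- (real k * t)))))"
        by (simp add: G_def S_def sum_distrib_left pow mult_ac)
      then show ?thesis by (simp add: algebra_simps flip: exp_add)
    qed
    then have "(LBINT t:{0<..}. G t * of_real (S n t)) = (\<Sum>k<n. (-1) ^ k * (Gamma z / of_real (real k + 1 / 2) powr z))"
      using I by (simp add: set_integral_sum)
    also have "\<dots> = (\<Sum>k<n. 2 powr z * Gamma z * ((-1) ^ k * of_nat (2 * k + 1) powr (- z)))"
    proof (rule sum.cong[OF refl])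
      fix k
      \<comment> \<open>Doubling k + 1/2 gives the odd integer 2k + 1 and accounts for the factor
        \<open>2 powr z\<close>.\<close>
      have "complex_of_real (2 * (real k + 1 / 2)) powr z = 2 powr z * of_real (real k + 1 / 2) powr z"
        by (subst of_real_powr_mult) (auto simp: add_nonneg_pos)
      also have "complex_of_real (2 * (real k + 1 / 2)) = of_nat (2 * k + 1)" by simp
      finally have "of_nat (2 * k + 1) powr (- z) = 1 / (2 powr z * complex_of_real (real k + 1 / 2) powr z)"
        by (simp only: powr_minus_divide)
      then show "(-1) ^ k * (Gamma z / of_real (real k + 1 / 2) powr z)
         = 2 powr z * Gamma z * ((-1) ^ k * of_nat (2 * k + 1) powr (- z))"
        by (simp only:) simp
    qed
    finally show ?thesis by (simp add: sum_distrib_left)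
  qed
  have "Gamma z \<noteq> 0" using z by (auto simp: Gamma_eq_zero_iff elim!: nonpos_Ints_cases')
  moreover have "(\<lambda>n. 2 powr z * Gamma z * (\<Sum>k<n. (-1) ^ k * of_nat (2 * k + 1) powr (- z))) \<longlonglongrightarrow> sech_mellin z"
    using D(2) by (simp add: partial sech_mellin_def)
  then have "(\<lambda>n. 2 powr z * Gamma z * (\<Sum>k<n. (-1) ^ k * of_nat (2 * k + 1) powr (- z)) / (2 powr z * Gamma z))
     \<longlonglongrightarrow> sech_mellin z / (2 powr z * Gamma z)"
    by (rule tendsto_divide[OF _ tendsto_const]) (use calculation in auto)
  ultimately show "(\<lambda>n. (-1) ^ n * of_nat (2 * n + 1) powr (- z)) sums (sech_mellin z / (2 powr z * Gamma z))"
    by (simp add: sums_def)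
qed

text \<open>This is J(z, Y) of the overview.\<close>

definition sech_stieltjes :: "complex \<Rightarrow> real \<Rightarrow> complex" where
  "sech_stieltjes z Y = (LBINT t:{0<..}. of_real t powr (z - 1) * of_real (sech_half t) / of_real (t\<^sup>2 + Y\<^sup>2))"

text \<open>Both parts compare 1 / (t^2 + Y^2) with 1 / Y^2. The norm bound later makes J(z + 2, Y)
  vanish as Y tends to infinity.\<close>

lemma sech_stieltjes_integrable:
  assumes z: "Re z > 0" and Y: "Y > 0"
  shows "set_integrable lborel {0<..}
    (\<lambda>t. complex_of_real t powr (z - 1) * of_real (sech_half t) / of_real (t\<^sup>2 + Y\<^sup>2))"
    and "norm (sech_stieltjes z Y) \<le> (LBINT t:{0<..}. norm (complex_of_real t powr (z - 1) * of_real (sech_half t))) / Y\<^sup>2"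
proof -
  let ?g = "\<lambda>t. complex_of_real t powr (z - 1) * of_real (sech_half t)"
  have le: "norm (?g t / of_real (t\<^sup>2 + Y\<^sup>2)) \<le> norm (?g t) / Y\<^sup>2" for t
  proof -
    have "norm (?g t) / \<bar>t\<^sup>2 + Y\<^sup>2\<bar> \<le> norm (?g t) / Y\<^sup>2"
      using Y by (intro divide_left_mono) (auto simp: add_nonneg_pos)
    then show ?thesis by (simp only: norm_divide norm_of_real)
  qed
  have g: "set_integrable lborel {0<..} ?g" by (rule sech_mellin_integrable[OF z])
  have g': "set_integrable lborel {0<..} (\<lambda>t. norm (?g t) / Y\<^sup>2)"
    using set_integrable_norm[OF g] by (intro set_integrable_divide) simp
  have ne: "complex_of_real (t\<^sup>2 + Y\<^sup>2) \<noteq> 0" for t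
    using Y by (metis add_nonneg_pos less_irrefl of_real_eq_0_iff zero_le_power2 zero_less_power)
  have m: "set_borel_measurable lborel {0<..} (\<lambda>t. ?g t / of_real (t\<^sup>2 + Y\<^sup>2))"
    using ne by (intro set_borel_measurable_continuous continuous_intros) auto
  show int: "set_integrable lborel {0<..} (\<lambda>t. ?g t / of_real (t\<^sup>2 + Y\<^sup>2))"
    by (rule set_integrable_bound[OF g' m]) (use le in \<open>auto simp del: of_real_add\<close>)
  have "norm (sech_stieltjes z Y) \<le> (LBINT t:{0<..}. norm (?g t / of_real (t\<^sup>2 + Y\<^sup>2)))"
    unfolding sech_stieltjes_def by (rule set_integral_norm_bound[OF int])
  also have "\<dots> \<le> (LBINT t:{0<..}. norm (?g t) / Y\<^sup>2)"
    by (rule set_integral_mono[OF set_integrable_norm[OF int] g' le])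
  finally show "norm (sech_stieltjes z Y) \<le> (LBINT t:{0<..}. norm (?g t)) / Y\<^sup>2" by simp
qed

text \<open>On the level of integrands, t^(z+1) + Y^2 t^(z-1) = (t^2 + Y^2) t^(z-1), and the
  denominator cancels.\<close>

lemma sech_stieltjes_step:
  assumes z: "Re z > 0" and Y: "Y > 0"
  shows "sech_stieltjes (z + 2) Y + of_real (Y\<^sup>2) * sech_stieltjes z Y = sech_mellin z"
proof -
  let ?g = "\<lambda>t. complex_of_real t powr (z - 1) * of_real (sech_half t)"
  let ?k = "\<lambda>z t. complex_of_real t powr (z - 1) * of_real (sech_half t) / of_real (t\<^sup>2 + Y\<^sup>2)"
  have eq: "?k (z + 2) t + of_real (Y\<^sup>2) * ?k z t = ?g t" if t: "t > 0" for t
  proof -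
    have "t\<^sup>2 + Y\<^sup>2 > 0" using Y by (simp add: add_nonneg_pos)
    then have ne: "complex_of_real (t\<^sup>2 + Y\<^sup>2) \<noteq> 0" by (metis less_irrefl of_real_eq_0_iff)
    have "complex_of_real t powr (z + 2 - 1) = of_real (t\<^sup>2) * complex_of_real t powr (z - 1)"
    proof -
      have "complex_of_real t powr (z + 2 - 1) = complex_of_real t powr (of_nat 2 + (z - 1))" by (simp add: algebra_simps)
      also have "\<dots> = complex_of_real t powr (of_nat 2) * complex_of_real t powr (z - 1)" by (rule powr_add)
      finally show ?thesis using t by (simp only: powr_nat') (simp add: powr_nat')
    qed
    then have "?k (z + 2) t + of_real (Y\<^sup>2) * ?k z t = of_real (t\<^sup>2 + Y\<^sup>2) * ?g t / of_real (t\<^sup>2 + Y\<^sup>2)"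
      by (simp add: algebra_simps add_divide_distrib)
    then show ?thesis using ne by (simp del: of_real_add)
  qed
  have I: "set_integrable lborel {0<..} (?k (z + 2))" "set_integrable lborel {0<..} (\<lambda>t. of_real (Y\<^sup>2) * ?k z t)"
    using sech_stieltjes_integrable(1)[of "z + 2" Y] z Y
    by (simp, intro set_integrable_mult_right sech_stieltjes_integrable(1) z Y)
  have "sech_mellin z = (LBINT t:{0<..}. ?k (z + 2) t + of_real (Y\<^sup>2) * ?k z t)"
    unfolding sech_mellin_def by (rule set_lebesgue_integral_cong) (use eq in auto)
  also have "\<dots> = sech_stieltjes (z + 2) Y + of_real (Y\<^sup>2) * sech_stieltjes z Y"
    unfolding set_integral_add(2)[OF I] sech_stieltjes_def set_integral_mult_right ..
  finally show ?thesis ..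
qed

text \<open>Insert \<open>sech_stieltjes_step\<close> at z = s - 2j: the alternating signs make the
  sum telescope, leaving the first and the last transform. \<open>Re s > 2 * real m\<close> keeps
  every argument in the right half-plane.\<close>

lemma sech_mellin_expansion:
  assumes "Re s > 2 * real m" and Y: "Y > 0"
  shows "(\<Sum>j=1..m. (-1) ^ (j - 1) * sech_mellin (s - 2 * of_nat j) * of_real (Y ^ (2 * j)))
     = of_real (Y\<^sup>2) * sech_stieltjes s Y - (-1) ^ m * of_real (Y ^ (2 * (m + 1))) * sech_stieltjes (s - 2 * of_nat m) Y"
  using assms(1)
proof (induction m)
  case (Suc m)
  define A where "A = sech_stieltjes (s - 2 * of_nat m) Y"
  define B where "B = sech_stieltjes (s - 2 * of_nat (Suc m)) Y"
  define p where "p = complex_of_real (Y ^ (2 * (m + 1)))"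
  have K: "sech_mellin (s - 2 * of_nat (Suc m)) = A + of_real (Y\<^sup>2) * B"
    using sech_stieltjes_step[of "s - 2 * of_nat (Suc m)" Y] Suc.prems Y
    by (simp add: A_def B_def algebra_simps)
  have p: "complex_of_real (Y ^ (2 * (Suc m + 1))) = of_real (Y\<^sup>2) * p"
    by (simp add: p_def power_add power2_eq_square)
  have "(\<Sum>j=1..Suc m. (-1) ^ (j - 1) * sech_mellin (s - 2 * of_nat j) * of_real (Y ^ (2 * j)))
    = (of_real (Y\<^sup>2) * sech_stieltjes s Y - (-1) ^ m * p * A) + (-1) ^ m * (A + of_real (Y\<^sup>2) * B) * p"
    using Suc.IH Suc.prems by (simp add: K[simplified] A_def[symmetric] p_def[simplified])
  then show ?case
    unfolding p B_def[symmetric] by (simp add: algebra_simps)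
qed (simp add: power2_eq_square)

text \<open>By the step relation the function is K(z) - J(z + 2, Y), and the norm bound for J(z + 2,
  Y) is O(1/Y^2).\<close>

lemma sech_stieltjes_tendsto:
  assumes z: "Re z > 0"
  shows "((\<lambda>Y. of_real (Y\<^sup>2) * sech_stieltjes z Y) \<longlongrightarrow> sech_mellin z) at_top"
proof -
  define C where "C = (LBINT t:{0<..}. norm (complex_of_real t powr (z + 2 - 1) * of_real (sech_half t)))"
  have "((\<lambda>Y. C / Y\<^sup>2) \<longlongrightarrow> 0) at_top"
    by (intro tendsto_divide_0[OF tendsto_const] filterlim_at_top_imp_at_infinity filterlim_pow_at_top filterlim_ident) simp
  moreover have "\<forall>\<^sub>F Y in at_top. norm (sech_stieltjes (z + 2) Y) \<le> C / Y\<^sup>2"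
    using eventually_gt_at_top[of 0]
    by eventually_elim (use sech_stieltjes_integrable(2)[of "z + 2"] z in \<open>simp add: C_def\<close>)
  ultimately have "((\<lambda>Y. sech_stieltjes (z + 2) Y) \<longlongrightarrow> 0) at_top"
    by (rule Lim_null_comparison[rotated])
  then have "((\<lambda>Y. sech_mellin z - sech_stieltjes (z + 2) Y) \<longlongrightarrow> sech_mellin z - 0) at_top"
    by (intro tendsto_intros)
  moreover have "\<forall>\<^sub>F Y in at_top. sech_mellin z - sech_stieltjes (z + 2) Y = of_real (Y\<^sup>2) * sech_stieltjes z Y"
    using eventually_gt_at_top[of 0]
    by eventually_elim (use sech_stieltjes_step[OF z] in \<open>simp add: algebra_simps\<close>)
  ultimately show ?thesis by (simp add: tendsto_cong)
qed

section \<open>Series over the zeros of the cosine, and the closed form of the Stieltjes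
  transform\<close>

text \<open>The positive zeros of the cosine: they belong to the variable \<open>y\<close>, as
  \<open>odd_pi\<close> belongs to \<open>Y = 2 y\<close>.\<close>

definition half_pi :: "nat \<Rightarrow> real" where
  "half_pi n = pi * (real n + 1 / 2)"

lemma half_pi_ge: "real (Suc n) \<le> half_pi n"
proof -
  have "3 * (real n + 1 / 2) \<le> half_pi n"
    unfolding half_pi_def using pi_gt3 by (intro mult_right_mono) auto
  then show ?thesis by simp
qed

lemma half_pi_pos: "half_pi n > 0"
  using half_pi_ge[of n] by simp

lemma odd_pi_eq: "odd_pi n = 2 * half_pi n"
  by (simp add: odd_pi_def half_pi_def)

lemma cos_half_pi: "cos (half_pi n) = 0"
  by (simp add: half_pi_def algebra_simps cos_add)

text \<open>A common majorant for the series below: 2 / (half_pi n)^2 bounds their kernels for large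
  \<open>n\<close>, and the terms are of order n^(Re w - 3) with exponent below -1.\<close>

lemma summable_half_pi_powr:
  assumes "Re w < 2"
  shows "summable (\<lambda>n. norm (complex_of_real (half_pi n) powr (w - 1)) * (2 / (half_pi n)\<^sup>2))"
proof (rule summable_comparison_test)
  have "summable (\<lambda>n. real (Suc n) powr (Re w - 3))"
    unfolding summable_Suc_iff[of "\<lambda>n. real n powr (Re w - 3)"] summable_real_powr_iff using assms by simp
  then show "summable (\<lambda>n. 2 * real (Suc n) powr (Re w - 3))" by (rule summable_mult)
  have "norm (complex_of_real (half_pi n) powr (w - 1)) * (2 / (half_pi n)\<^sup>2) \<le> 2 * real (Suc n) powr (Re w - 3)" for n
  proof -
    have "norm (complex_of_real (half_pi n) powr (w - 1)) = half_pi n powr (Re w - 1)"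
      using half_pi_pos[of n] by (simp add: of_real_powr_eq_exp powr_def)
    moreover have "(half_pi n)\<^sup>2 = half_pi n powr 2"
      using half_pi_pos[of n] by (simp add: powr_numeral)
    moreover have "half_pi n powr (Re w - 1) / half_pi n powr 2 = half_pi n powr (Re w - 3)"
      by (simp flip: powr_diff)
    moreover have "half_pi n powr (Re w - 3) \<le> real (Suc n) powr (Re w - 3)"
      using assms half_pi_ge[of n] by (intro powr_mono2') auto
    ultimately have "norm (complex_of_real (half_pi n) powr (w - 1)) / (half_pi n)\<^sup>2 \<le> real (Suc n) powr (Re w - 3)"
      by (simp only:)
    then have "2 * (norm (complex_of_real (half_pi n) powr (w - 1)) / (half_pi n)\<^sup>2) \<le> 2 * real (Suc n) powr (Re w - 3)"
      by (rule mult_left_mono) simp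
    then show ?thesis by (simp only: times_divide_eq_right mult_ac)
  qed
  then show "\<exists>N. \<forall>n\<ge>N. norm (norm (complex_of_real (half_pi n) powr (w - 1)) * (2 / (half_pi n)\<^sup>2)) \<le> 2 * real (Suc n) powr (Re w - 3)"
    by auto
qed

text \<open>For n >= 2R one has 2 |y| <= \<open>half_pi n\<close>, so y^2 is at most a quarter of
  (half_pi n)^2. The threshold depends only on \<open>R\<close>, which gives the uniformity required
  by Tannery's theorem.\<close>

lemma half_pi_square_diff:
  assumes "\<bar>y\<bar> \<le> R" "2 * R \<le> real n"
  shows "(half_pi n)\<^sup>2 / 2 \<le> \<bar>y\<^sup>2 - (half_pi n)\<^sup>2\<bar>"
proof -
  have "2 * \<bar>y\<bar> \<le> half_pi n" using assms half_pi_ge[of n] by simp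
  then have "(2 * \<bar>y\<bar>)\<^sup>2 \<le> (half_pi n)\<^sup>2" by (intro power_mono) auto
  then have "4 * y\<^sup>2 \<le> (half_pi n)\<^sup>2" by (simp add: power_mult_distrib)
  moreover have "0 \<le> y\<^sup>2" by simp
  ultimately have "(half_pi n)\<^sup>2 / 2 \<le> - (y\<^sup>2 - (half_pi n)\<^sup>2)" by linarith
  then show ?thesis using abs_ge_minus_self order.trans by blast
qed

lemma half_pi_square_diff_inverse:
  assumes "\<bar>y\<bar> \<le> R" "2 * R \<le> real n"
  shows "y\<^sup>2 \<noteq> (half_pi n)\<^sup>2" and "\<bar>c\<bar> \<le> 1 \<Longrightarrow> \<bar>c / (y\<^sup>2 - (half_pi n)\<^sup>2)\<bar> \<le> 2 / (half_pi n)\<^sup>2"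
proof -
  have pos: "(half_pi n)\<^sup>2 > 0" using half_pi_pos[of n] by simp
  note d = half_pi_square_diff[OF assms]
  show "y\<^sup>2 \<noteq> (half_pi n)\<^sup>2" using d pos by auto
  assume c: "\<bar>c\<bar> \<le> 1"
  have "\<bar>c\<bar> / \<bar>y\<^sup>2 - (half_pi n)\<^sup>2\<bar> \<le> 1 / ((half_pi n)\<^sup>2 / 2)"
    using d pos c by (intro frac_le) auto
  then show "\<bar>c / (y\<^sup>2 - (half_pi n)\<^sup>2)\<bar> \<le> 2 / (half_pi n)\<^sup>2" by simp
qed

lemma half_pi_series_summable:
  fixes c :: "nat \<Rightarrow> real"
  assumes w: "Re w < 2" and c: "\<And>n. \<bar>c n\<bar> \<le> 1"
  shows "summable (\<lambda>n. norm (complex_of_real (half_pi n) powr (w - 1) * of_real (c n / (y\<^sup>2 - (half_pi n)\<^sup>2))))"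
proof (rule summable_comparison_test_ev[OF _ summable_half_pi_powr[OF w]])
  show "\<forall>\<^sub>F n in sequentially. norm (norm (complex_of_real (half_pi n) powr (w - 1) * of_real (c n / (y\<^sup>2 - (half_pi n)\<^sup>2))))
      \<le> norm (complex_of_real (half_pi n) powr (w - 1)) * (2 / (half_pi n)\<^sup>2)"
    using eventually_ge_at_top[of "nat \<lceil>2 * \<bar>y\<bar>\<rceil>"]
  proof eventually_elim
    case (elim n)
    then have "2 * \<bar>y\<bar> \<le> real n" by linarith
    from half_pi_square_diff_inverse(2)[OF order.refl this c]
    have "\<bar>c n / (y\<^sup>2 - (half_pi n)\<^sup>2)\<bar> \<le> 2 / (half_pi n)\<^sup>2" .
    then show ?case
      unfolding real_norm_def norm_mult norm_of_real abs_mult abs_abs abs_norm_cancel by (intro mult_left_mono) auto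
  qed
qed

lemma cos_nonzero_half_pi:
  assumes "cos y \<noteq> 0"
  shows "y\<^sup>2 \<noteq> (half_pi n)\<^sup>2"
proof
  assume "y\<^sup>2 = (half_pi n)\<^sup>2"
  then have "y = half_pi n \<or> y = - half_pi n" by (simp add: power2_eq_iff)
  then show False using assms cos_half_pi[of n] by auto
qed

text \<open>Each partial fraction of \<open>sech_half\<close> contributes, by
  \<open>stieltjes_kernel_product_integral\<close>, a difference of a power of
  \<open>odd_pi k\<close> and a power of \<open>Y = 2 y\<close>. The former add up to the series;
  the latter have a common factor, and their coefficients add up to 1 / (2 cos y).\<close>

lemma sech_stieltjes_eq:
  assumes w: "0 < Re w" "Re w < 2" and y: "y > 0" and c: "cos y \<noteq> 0"
  shows "sech_stieltjes w (2 * y) = of_real pi * 2 powr (w - 2) / (2 * sin (of_real pi * w / 2)) *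
     ((\<Sum>n. of_real (half_pi n) powr (w - 1) * of_real ((-1) ^ n / (y\<^sup>2 - (half_pi n)\<^sup>2)))
       + of_real y powr (w - 2) / (2 * of_real (cos y)))"
proof -
  define Y where "Y = 2 * y"
  define \<kappa> where "\<kappa> = of_real pi / (2 * sin (of_real pi * w / 2))"
  have Y: "Y > 0" using y by (simp add: Y_def)
  define G where "G = (\<lambda>t. complex_of_real t powr (w - 1) / of_real (t\<^sup>2 + Y\<^sup>2))"
  define S where "S = (\<lambda>n t. \<Sum>k<2*n. (-1) ^ k * (2 * odd_pi k) / (t\<^sup>2 + (odd_pi k)\<^sup>2))"
  \<comment> \<open>\<open>u\<close> collects the powers of \<open>odd_pi k\<close>, rescaled to
    \<open>half_pi k\<close>, and \<open>v\<close> the coefficients of the power of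
    \<open>Y\<close>.\<close>
  define u where "u = (\<lambda>k. complex_of_real (half_pi k) powr (w - 1) * of_real ((-1) ^ k / (y\<^sup>2 - (half_pi k)\<^sup>2)))"
  define v where "v = (\<lambda>k. (-1) ^ k * (2 * complex_of_real (odd_pi k)) / ((of_real (odd_pi k))\<^sup>2 - (of_real Y)\<^sup>2))"
  have G: "set_integrable lborel {0<..} G"
    unfolding G_def by (rule stieltjes_kernel_integral(1)[OF w Y])
  have ne: "t\<^sup>2 + (odd_pi k)\<^sup>2 \<noteq> 0" for t k
    using odd_pi_pos[of k] by (simp add: add_nonneg_eq_0_iff)
  have contS: "continuous_on {0<..} (S n)" for n
    unfolding S_def using ne by (intro continuous_intros) auto
  obtain C where C: "\<And>n t. \<bar>S n t\<bar> \<le> C"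
    using sech_half_partial_sums_bounded unfolding S_def by metis
  have "(\<lambda>n. LBINT t:{0<..}. G t * of_real (S n t)) \<longlonglongrightarrow> (LBINT t:{0<..}. G t * of_real (sech_half t))"
    by (rule dominated_product_integral(2)[OF _ G contS continuous_on_sech_half C])
       (simp_all add: S_def sech_half_partial_fractions)
  also have "(LBINT t:{0<..}. G t * of_real (sech_half t)) = sech_stieltjes w Y"
    unfolding sech_stieltjes_def G_def by (simp add: mult.commute)
  finally have lim1: "(\<lambda>n. LBINT t:{0<..}. G t * of_real (S n t)) \<longlonglongrightarrow> sech_stieltjes w Y" .
  have alg1: "(e * (2 * b)) * (\<kappa>' * ((B - Y') / D)) = \<kappa>' * (e * 2 * (b * B) / D + Y' * (- (e * (2 * b) / D)))"
    and alg2: "\<kappa>' * (e * 2 * (P * 2 * B) / D + Y') = \<kappa>' * (P * (4 * e * B / D) + Y')"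
    for e b B \<kappa>' Y' P D :: complex
    by (simp_all add: divide_inverse algebra_simps)
  have alg3: "a * (P * B + P * D * (1 / z)) = a * P * (B + D / z)" for a P B D z :: complex
    by (simp add: algebra_simps)
  have term_eq: "(LBINT t:{0<..}. G t * of_real (S n t))
     = \<kappa> * (2 powr (w - 2) * (\<Sum>k<2*n. u k) + of_real Y powr (w - 2) * (\<Sum>k<2*n. v k))" for n
  proof -
    \<comment> \<open>A nonzero cos y keeps \<open>Y\<close> away from all \<open>odd_pi k\<close>,
      so the partial fractions in t^2 have distinct poles.\<close>
    have Yk: "odd_pi k \<noteq> Y" for k
      using cos_nonzero_half_pi[OF c, of k] by (auto simp: odd_pi_eq Y_def)
    have GS: "G t * of_real (S n t) = (\<Sum>k<2*n. of_real ((-1) ^ k * (2 * odd_pi k)) *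
       (complex_of_real t powr (w - 1) / of_real (t\<^sup>2 + Y\<^sup>2) / of_real (t\<^sup>2 + (odd_pi k)\<^sup>2)))" for t
      unfolding G_def S_def of_real_sum sum_distrib_left
      by (intro sum.cong refl) (simp only: of_real_divide times_divide_eq_left times_divide_eq_right mult_ac)
    have "(LBINT t:{0<..}. G t * of_real (S n t)) = (\<Sum>k<2*n. of_real ((-1) ^ k * (2 * odd_pi k)) *
       (\<kappa> * ((of_real (odd_pi k) powr (w - 2) - of_real Y powr (w - 2)) / of_real (Y\<^sup>2 - (odd_pi k)\<^sup>2))))"
      unfolding GS \<kappa>_def
      by (subst set_integral_sum)
         (intro set_integrable_mult_right stieltjes_kernel_product_integral(1)[OF w odd_pi_pos Y Yk],
          simp only: set_integral_mult_right stieltjes_kernel_product_integral(2)[OF w odd_pi_pos Y Yk])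
    also have "\<dots> = (\<Sum>k<2*n. \<kappa> * (2 powr (w - 2) * u k + of_real Y powr (w - 2) * v k))"
    proof (rule sum.cong[OF refl])
      fix k
      define b where "b = complex_of_real (odd_pi k)"
      define D where "D = complex_of_real (Y\<^sup>2 - (odd_pi k)\<^sup>2)"
      have D: "D \<noteq> 0" unfolding D_def of_real_eq_0_iff
        using Yk[of k] Y odd_pi_pos[of k] by (simp add: power2_eq_iff)
      \<comment> \<open>The numerator \<open>odd_pi k\<close> of the partial fraction raises the
        exponent from w - 2 to the w - 1 seen in the series.\<close>
      have b1: "b * b powr (w - 2) = 2 powr (w - 1) * of_real (half_pi k) powr (w - 1)"
      proof -
        have "b * b powr (w - 2) = b powr 1 * b powr (w - 2)"
          using odd_pi_pos[of k] by (simp add: b_def)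
        also have "\<dots> = b powr (1 + (w - 2))" by (rule powr_add[symmetric])
        also have "\<dots> = b powr (w - 1)" by (rule arg_cong) simp
        also have "\<dots> = 2 powr (w - 1) * of_real (half_pi k) powr (w - 1)"
          using of_real_powr_mult[of 2 "half_pi k" "w - 1"] half_pi_pos[of k] by (simp add: b_def odd_pi_eq)
        finally show ?thesis .
      qed
      have p: "(2::complex) powr (w - 1) = 2 powr (w - 2) * 2"
        using powr_add[of "2::complex" "w - 2" 1] by simp
      have Du: "u k = 4 * (-1) ^ k * of_real (half_pi k) powr (w - 1) / D"
      proof -
        have "D = 4 * complex_of_real (y\<^sup>2 - (half_pi k)\<^sup>2)" by (simp add: D_def Y_def odd_pi_eq power_mult_distrib)
        then show ?thesis by (simp only: u_def of_real_divide of_real_power of_real_minus of_real_1 times_divide_eq_right)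
            (simp only: mult.assoc mult_divide_mult_cancel_left_if, simp)
      qed
      have Dv: "v k = - ((-1) ^ k * (2 * b) / D)"
      proof -
        have "(of_real (odd_pi k))\<^sup>2 - (complex_of_real Y)\<^sup>2 = - D" by (simp add: D_def)
        then show ?thesis by (simp add: v_def b_def)
      qed
      have "of_real ((-1) ^ k * (2 * odd_pi k)) * (\<kappa> * ((b powr (w - 2) - of_real Y powr (w - 2)) / D))
        = \<kappa> * ((-1) ^ k * 2 * (b * b powr (w - 2)) / D + of_real Y powr (w - 2) * (- ((-1) ^ k * (2 * b) / D)))"
        using alg1[of "(-1) ^ k" b] by (simp add: b_def)
      also have "\<dots> = \<kappa> * (2 powr (w - 2) * u k + of_real Y powr (w - 2) * v k)"
        unfolding b1 p Du Dv[symmetric] by (simp only: alg2)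
      finally show "of_real ((-1) ^ k * (2 * odd_pi k)) *
       (\<kappa> * ((of_real (odd_pi k) powr (w - 2) - of_real Y powr (w - 2)) / of_real (Y\<^sup>2 - (odd_pi k)\<^sup>2)))
        = \<kappa> * (2 powr (w - 2) * u k + of_real Y powr (w - 2) * v k)"
        unfolding b_def D_def .
    qed
    finally show ?thesis by (simp only: sum_distrib_left sum.distrib distrib_left mult.assoc)
  qed
  have "\<bar>(-1::real) ^ n\<bar> \<le> 1" for n by (simp add: power_abs)
  from half_pi_series_summable[where c = "\<lambda>n. (-1) ^ n", OF w(2) this]
  have "summable (\<lambda>n. norm (u n))"
    unfolding u_def .
  \<comment> \<open>The sum over \<open>u\<close> converges absolutely, so even partial sums have
    the same limit. For \<open>v\<close> the secant expansion supplies the limit along even partial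
    sums, matching the \<open>2*n\<close> terms of \<open>S n\<close>.\<close>
  then have "(\<lambda>n. \<Sum>k<n. u k) \<longlonglongrightarrow> suminf u"
    by (rule summable_LIMSEQ[OF summable_norm_cancel])
  moreover have "filterlim (\<lambda>n::nat. 2 * n) sequentially sequentially"
    by (intro filterlim_subseq) (simp add: strict_mono_def)
  ultimately have lu: "(\<lambda>n. \<Sum>k<2*n. u k) \<longlonglongrightarrow> suminf u"
    by (rule filterlim_compose)
  have "cos (complex_of_real Y / 2) = of_real (cos y)"
    by (simp add: Y_def cos_of_real)
  with sec_partial_fractions_odd_pi[of "of_real Y"] c
  have lv: "(\<lambda>n. \<Sum>k<2*n. v k) \<longlonglongrightarrow> 1 / (2 * of_real (cos y))"
    by (simp add: v_def)
  have "(\<lambda>n. LBINT t:{0<..}. G t * of_real (S n t)) \<longlonglongrightarrow>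
     \<kappa> * (2 powr (w - 2) * suminf u + of_real Y powr (w - 2) * (1 / (2 * of_real (cos y))))"
    unfolding term_eq by (intro tendsto_intros lu lv)
  with lim1 have "sech_stieltjes w Y = \<kappa> * (2 powr (w - 2) * suminf u + of_real Y powr (w - 2) * (1 / (2 * of_real (cos y))))"
    by (rule LIMSEQ_unique)
  also have "of_real Y powr (w - 2) = 2 powr (w - 2) * of_real y powr (w - 2)"
    using of_real_powr_mult[of 2 y "w - 2"] y by (simp add: Y_def)
  also have "\<kappa> * (2 powr (w - 2) * suminf u + 2 powr (w - 2) * of_real y powr (w - 2) * (1 / (2 * of_real (cos y))))
    = of_real pi * 2 powr (w - 2) / (2 * sin (of_real pi * w / 2)) * (suminf u + of_real y powr (w - 2) / (2 * of_real (cos y)))"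
    unfolding alg3 by (simp add: \<kappa>_def)
  finally show ?thesis unfolding Y_def[symmetric] u_def[symmetric] .
qed

section \<open>The trigonometric kernels and their series\<close>

lemma tendsto_imp_extend_eq:
  fixes F :: "real \<Rightarrow> 'a :: t2_space"
  assumes "(F \<longlongrightarrow> l) (at y)" "y \<in> Z"
  shows "extend Z F y = l"
  using assms tendsto_Lim[OF _ assms(1)] by (simp add: extend_def)

definition cos_kernel :: "nat \<Rightarrow> real \<Rightarrow> real" where
  "cos_kernel n = extend {x. x\<^sup>2 = (half_pi n)\<^sup>2} (\<lambda>x. cos x / (x\<^sup>2 - (half_pi n)\<^sup>2))"

lemma cos_kernel_eq: "y\<^sup>2 \<noteq> (half_pi n)\<^sup>2 \<Longrightarrow> cos_kernel n y = cos y / (y\<^sup>2 - (half_pi n)\<^sup>2)"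
  by (simp add: cos_kernel_def extend_def)

text \<open>At a singular point y the cosine vanishes and y^2 = (half_pi n)^2, so the quotient is
  the difference quotient of the cosine times 1 / (x + y), with a finite limit because y is
  nonzero.\<close>

lemma cos_kernel_limit:
  "((\<lambda>x. cos x / (x\<^sup>2 - (half_pi n)\<^sup>2)) \<longlongrightarrow> cos_kernel n y) (at y)"
proof (cases "y\<^sup>2 = (half_pi n)\<^sup>2")
  case True
  have y: "y \<noteq> 0" "cos y = 0"
    using True half_pi_pos[of n] cos_half_pi[of n] cos_nonzero_half_pi[of y n] by auto
  have "((\<lambda>x. (cos x - cos y) / (x - y)) \<longlongrightarrow> - sin y) (at y)"
    using DERIV_cos[of y] by (simp add: has_field_derivative_iff)
  moreover have "((\<lambda>x. 1 / (x + y)) \<longlongrightarrow> 1 / (y + y)) (at y)"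
    using y by (intro tendsto_intros) auto
  ultimately have "((\<lambda>x. (cos x - cos y) / (x - y) * (1 / (x + y))) \<longlongrightarrow> - sin y * (1 / (y + y))) (at y)"
    by (rule tendsto_mult)
  moreover have "(cos x - cos y) / (x - y) * (1 / (x + y)) = cos x / (x\<^sup>2 - (half_pi n)\<^sup>2)" for x
    unfolding True[symmetric] using y by (simp add: power2_eq_square square_diff_square_factored mult.commute)
  ultimately have lim: "((\<lambda>x. cos x / (x\<^sup>2 - (half_pi n)\<^sup>2)) \<longlongrightarrow> - sin y * (1 / (y + y))) (at y)"
    by simp
  moreover from lim have "cos_kernel n y = - sin y * (1 / (y + y))"
    unfolding cos_kernel_def by (rule tendsto_imp_extend_eq) (use True in simp)
  ultimately show ?thesis by simp
next
  case False
  then show ?thesis by (auto simp: cos_kernel_eq intro!: tendsto_intros)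
qed

lemma cos_kernel_tendsto: "(cos_kernel n \<longlongrightarrow> cos_kernel n y) (at y)"
proof (rule Lim_transform_eventually[OF cos_kernel_limit])
  \<comment> \<open>The kernel can differ from the plain quotient only at these two points; a
    punctured neighbourhood of \<open>y\<close> avoids both.\<close>
  have "finite {half_pi n, - half_pi n}" by simp
  then have "\<forall>\<^sub>F x in at y. x \<notin> {half_pi n, - half_pi n} - {y}"
    using islimpt_finite[of "{half_pi n, - half_pi n} - {y}" y] by (auto simp: islimpt_iff_eventually)
  moreover have "\<forall>\<^sub>F x in at y. x \<noteq> y" by (simp add: eventually_at_filter)
  ultimately show "\<forall>\<^sub>F x in at y. cos x / (x\<^sup>2 - (half_pi n)\<^sup>2) = cos_kernel n x"
  proof eventually_elim
    case (elim x)
    then have "x\<^sup>2 \<noteq> (half_pi n)\<^sup>2" by (auto simp: power2_eq_iff)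
    then show ?case by (simp add: cos_kernel_eq)
  qed
qed

lemma cos_kernel_le:
  assumes "\<bar>y\<bar> \<le> R" "2 * R \<le> real n"
  shows "\<bar>cos_kernel n y\<bar> \<le> 2 / (half_pi n)\<^sup>2"
  using half_pi_square_diff_inverse[OF assms] by (simp add: cos_kernel_eq)

text \<open>The double-angle formula at x = 2y, with pi (2n + 1) = 2 \<open>half_pi n\<close>, turns
  the kernel of \<open>gamma4\<close> into that of \<open>g1_half\<close>. At a singular point the
  limit is carried over along x / 2.\<close>

lemma sin_kernel_eq:
  "extend {x. x\<^sup>2 = (pi * real (2 * n + 1))\<^sup>2} (\<lambda>x. sin x / (x\<^sup>2 - (pi * real (2 * n + 1))\<^sup>2)) (2 * y)
     = sin y / 2 * cos_kernel n y"
proof -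
  have h: "pi * real (2 * n + 1) = 2 * half_pi n" by (simp add: half_pi_def algebra_simps)
  have F: "sin x / (x\<^sup>2 - (2 * half_pi n)\<^sup>2) = sin (x / 2) / 2 * (cos (x / 2) / ((x / 2)\<^sup>2 - (half_pi n)\<^sup>2))" for x
  proof -
    have "sin x = 2 * sin (x / 2) * cos (x / 2)" using sin_double[of "x / 2"] by simp
    moreover have "x\<^sup>2 - (2 * half_pi n)\<^sup>2 = 4 * ((x / 2)\<^sup>2 - (half_pi n)\<^sup>2)"
      by (simp add: power_mult_distrib power_divide)
    moreover have "2 * a * b / (4 * c) = a / 2 * (b / c)" for a b c :: real by simp
    ultimately show ?thesis by (simp only:)
  qed
  show ?thesis unfolding h
  proof (cases "y\<^sup>2 = (half_pi n)\<^sup>2")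
    case True
    have "filterlim (\<lambda>x::real. x / 2) (at y) (at (2 * y))"
      unfolding filterlim_at by (auto simp: eventually_at_filter intro!: tendsto_eq_intros)
    moreover have "((\<lambda>u. sin u / 2 * (cos u / (u\<^sup>2 - (half_pi n)\<^sup>2))) \<longlongrightarrow> sin y / 2 * cos_kernel n y) (at y)"
      by (intro tendsto_mult cos_kernel_limit tendsto_intros) simp
    ultimately have "((\<lambda>x. sin x / (x\<^sup>2 - (2 * half_pi n)\<^sup>2)) \<longlongrightarrow> sin y / 2 * cos_kernel n y) (at (2 * y))"
      unfolding F by (rule filterlim_compose[rotated])
    then show "extend {x. x\<^sup>2 = (2 * half_pi n)\<^sup>2} (\<lambda>x. sin x / (x\<^sup>2 - (2 * half_pi n)\<^sup>2)) (2 * y) = sin y / 2 * cos_kernel n y"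
      by (rule tendsto_imp_extend_eq) (use True in \<open>simp add: power_mult_distrib\<close>)
  next
    case False
    then have "(2 * y)\<^sup>2 \<noteq> (2 * half_pi n)\<^sup>2" by (simp add: power_mult_distrib)
    then show "extend {x. x\<^sup>2 = (2 * half_pi n)\<^sup>2} (\<lambda>x. sin x / (x\<^sup>2 - (2 * half_pi n)\<^sup>2)) (2 * y) = sin y / 2 * cos_kernel n y"
      using False F[of "2 * y"] by (simp add: extend_def cos_kernel_eq)
  qed
qed

text \<open>The series shared by \<open>gamma4\<close> and \<open>g1_half\<close>, up to elementary
  factors. The sign comes from sin(pi (n + 1/2) + pi s/2) = (-1)^n cos(pi s/2).\<close>

definition cos_series :: "complex \<Rightarrow> real \<Rightarrow> complex" where
  "cos_series w y = (\<Sum>n. of_real (half_pi n) powr (w - 1) * of_real ((-1) ^ n * cos_kernel n y))"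

lemma cos_series_term_le:
  assumes "\<bar>y\<bar> \<le> R" "2 * R \<le> real n"
  shows "norm (complex_of_real (half_pi n) powr (w - 1) * of_real ((-1) ^ n * cos_kernel n y))
     \<le> norm (complex_of_real (half_pi n) powr (w - 1)) * (2 / (half_pi n)\<^sup>2)"
proof -
  have "\<bar>(-1) ^ n * cos_kernel n y\<bar> \<le> 2 / (half_pi n)\<^sup>2"
    using cos_kernel_le[OF assms] by (simp add: abs_mult power_abs)
  then show ?thesis unfolding norm_mult norm_of_real by (intro mult_left_mono) auto
qed

text \<open>Tannery's theorem: for |x| <= |y| + 1 all terms from a common index on lie below the
  summable majorant, and each term is continuous at \<open>y\<close>.\<close>

lemma
  assumes w: "Re w < 2"
  shows summable_cos_series:
    "summable (\<lambda>n. norm (complex_of_real (half_pi n) powr (w - 1) * of_real ((-1) ^ n * cos_kernel n y)))"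
    and cos_series_tendsto: "(cos_series w \<longlongrightarrow> cos_series w y) (at y)"
proof -
  let ?a = "\<lambda>n y. complex_of_real (half_pi n) powr (w - 1) * of_real ((-1) ^ n * cos_kernel n y)"
  define R where "R = \<bar>y\<bar> + 1"
  have nR: "2 * R \<le> real n" if "n \<ge> nat \<lceil>2 * R\<rceil>" for n using that by linarith
  have "\<forall>\<^sub>F x in at y. dist x y < 1"
    unfolding eventually_at by (auto intro!: exI[of _ 1])
  then have "\<forall>\<^sub>F x in at y. \<bar>x\<bar> \<le> R"
    by eventually_elim (auto simp: R_def dist_real_def)
  then have "\<forall>\<^sub>F (n, x) in at_top \<times>\<^sub>F at y. n \<ge> nat \<lceil>2 * R\<rceil> \<and> \<bar>x\<bar> \<le> R"
    using eventually_ge_at_top[of "nat \<lceil>2 * R\<rceil>"]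
    by (intro eventually_prod_filter[THEN iffD2] exI[of _ "\<lambda>n. n \<ge> nat \<lceil>2 * R\<rceil>"] exI[of _ "\<lambda>x. \<bar>x\<bar> \<le> R"])
       auto
  then have "\<forall>\<^sub>F (n, x) in at_top \<times>\<^sub>F at y. norm (?a n x) \<le> norm (complex_of_real (half_pi n) powr (w - 1)) * (2 / (half_pi n)\<^sup>2)"
    by (rule eventually_mono) (clarify, rule cos_series_term_le[OF _ nR])
  moreover have "(?a n \<longlongrightarrow> ?a n y) (at y)" for n
    by (intro tendsto_intros cos_kernel_tendsto)
  ultimately have "summable (\<lambda>n. norm (?a n y)) \<and> ((\<lambda>x. \<Sum>n. ?a n x) \<longlongrightarrow> (\<Sum>n. ?a n y)) (at y)"
    using tannerys_theorem[of ?a "\<lambda>n. ?a n y" "at y", OF _ _ summable_half_pi_powr[OF w]] by simp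
  then show "summable (\<lambda>n. norm (?a n y))" "(cos_series w \<longlongrightarrow> cos_series w y) (at y)"
    by (simp_all add: cos_series_def[abs_def])
qed

section \<open>Character sums, special values and the factorisations of \<open>gamma4\<close> and
  \<open>phi4\<close>\<close>

lemma chi4_sum: "(\<Sum>l=1..3. chi4 l * f l) = f 1 - f 3"
proof -
  have "{1..3::int} = {1, 2, 3}" by auto
  then show ?thesis by (simp add: chi4_def)
qed

text \<open>The terms l = 1 and l = 3 are i^n and -(-i)^n, whose sum is i^n (1 - (-1)^n).\<close>

lemma mem_E_chi4_iff: "int n \<in> E_chi4 \<longleftrightarrow> even n"
proof -
  have i: "exp (\<i> * of_real (pi / 2)) = \<i>"
    by (metis cis_conv_exp cis_pi_half)
  have e: "exp (2 * of_real pi * \<i> * of_int (int n) * of_int l / 4) = (\<i> ^ nat l) ^ n" if "l \<ge> 0" for l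
  proof -
    have "2 * of_real pi * \<i> * of_int (int n) * of_int l / 4 = of_nat n * (of_nat (nat l) * (\<i> * of_real (pi / 2)))"
      using that by simp
    then show ?thesis by (simp only: exp_of_nat_mult i)
  qed
  have "(\<Sum>l=1..3. chi4 l * exp (2 * of_real pi * \<i> * of_int (int n) * of_int l / 4)) = \<i> ^ n - (- \<i>) ^ n"
    unfolding chi4_sum by (subst (1 2) e) (simp_all add: numeral_eq_Suc)
  also have "\<dots> = \<i> ^ n * (1 - (-1) ^ n)"
    by (subst power_minus) (simp add: algebra_simps)
  finally have "int n \<in> E_chi4 \<longleftrightarrow> \<i> ^ n * (1 - (-1) ^ n) = 0"
    unfolding E_chi4_def mem_Collect_eq by (simp only:)
  then show ?thesis by (cases "even n") auto
qed

lemma Gamma_nonzero_Re_pos: "Re z > 0 \<Longrightarrow> Gamma z \<noteq> 0"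
  by (auto simp: Gamma_eq_zero_iff elim!: nonpos_Ints_cases')

lemma L_chi4_eq:
  assumes "Re z > 0"
  shows "Gamma z * L_chi4 z = sech_mellin z / 2 powr z"
proof -
  have "L_chi4 z = sech_mellin z / (2 powr z * Gamma z)"
    unfolding L_chi4_def by (rule sums_unique[OF sech_mellin_sums[OF assms], symmetric])
  then show ?thesis using Gamma_nonzero_Re_pos[OF assms] by simp
qed

lemma Phi_minus1_half_eq:
  assumes "Re z > 0"
  shows "Gamma z * Phi_minus1 z (1 / 2) = sech_mellin z"
  using Gamma_nonzero_Re_pos[OF assms]
  by (simp add: Phi_minus1_def sech_mellin_def sech_half_def)

lemma two_powr_diff: "(2::complex) powr (s - 2 * of_nat j) * 2 ^ (2 * j) = 2 powr s"
proof -
  have "(2::complex) ^ (2 * j) = 2 powr (of_nat (2 * j))" by (subst powr_nat') auto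
  then have "(2::complex) powr (s - 2 * of_nat j) * 2 ^ (2 * j) = 2 powr (s - 2 * of_nat j + of_nat (2 * j))"
    by (simp only: powr_add)
  also have "s - 2 * of_nat j + of_nat (2 * j) = s" by simp
  finally show ?thesis .
qed

lemma four_powr: "(4::complex) powr z = 2 powr z * 2 powr z"
  using of_real_powr_mult[of 2 2 z] by simp

lemma sin_npi_complex: "sin (of_nat n * complex_of_real pi) = 0"
  and cos_npi_complex: "cos (of_nat n * complex_of_real pi) = (-1) ^ n"
  using sin_of_real[of "real n * pi", where 'a = complex] cos_of_real[of "real n * pi", where 'a = complex]
  by (simp_all del: sin_of_real cos_of_real)

lemma sin_shift_half_pi:
  "sin (of_real pi * (of_nat n + 1 / 2) + z) = (-1) ^ n * cos (z::complex)"
proof -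
  have "of_real pi * (of_nat n + 1 / 2) + z = of_nat n * of_real pi + (of_real (pi / 2) + z)"
    by (simp add: algebra_simps)
  moreover have "sin (of_nat n * of_real pi + u) = (-1) ^ n * sin u" for u :: complex
    by (simp only: sin_add sin_npi_complex cos_npi_complex) simp
  moreover have "sin (of_real (pi / 2) + z) = cos z"
    by (simp only: sin_add sin_of_real cos_of_real sin_pi_half cos_pi_half) simp
  ultimately show ?thesis by (simp only:)
qed

text \<open>Excluding even positive \<open>Re s\<close> makes the lower floor bound strict, so that
  w = s - 2 \<open>m1 s\<close> has real part strictly between 0 and 2, the range of the kernel
  integrals.\<close>

lemma Re_m1:
  assumes "Re s > 0" "\<forall>k::nat. k \<ge> 1 \<longrightarrow> Re s \<noteq> 2 * real k"
  shows "2 * real (m1 s) < Re s" "Re s < 2 * real (m1 s) + 2"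
proof -
  have m: "real (m1 s) = of_int \<lfloor>Re s / 2\<rfloor>"
    using assms(1) by (simp add: m1_def)
  have "2 * real (m1 s) \<noteq> Re s"
    using assms(1) assms(2)[rule_format, of "m1 s"] by (cases "m1 s = 0") auto
  then show "2 * real (m1 s) < Re s"
    using of_int_floor_le[of "Re s / 2"] unfolding m[symmetric] by simp
  show "Re s < 2 * real (m1 s) + 2"
    using real_of_int_floor_add_one_gt[of "Re s / 2"] unfolding m[symmetric] by simp
qed

text \<open>The polynomial part of g without its factor cos y, as a function of Y = 2y and with
  Gamma times Phi already replaced by K.\<close>

definition mellin_poly :: "complex \<Rightarrow> real \<Rightarrow> complex" where
  "mellin_poly s Y = (\<Sum>j=1..m1 s. (-1) ^ (j - 1) * sech_mellin (s - 2 * of_nat j) * of_real (Y ^ (2 * j)))"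

lemma g1_half_eq:
  assumes "2 * real (m1 s) < Re s" "Re s < 2 * real (m1 s) + 2"
  shows "g1_half s y = - (of_real (cos y) * mellin_poly s (2 * y)
     + of_real pi * 2 powr s * of_real (y ^ (2 * (m1 s + 1))) / sin (of_real pi * s)
       * (cos (of_real pi * s / 2) * cos_series (s - 2 * of_nat (m1 s)) y))"
proof -
  have "(\<Sum>j=1..m1 s. (-1) ^ (j - 1) * Gamma (s - 2 * of_nat j) * Phi_minus1 (s - 2 * of_nat j) (1/2)
             * of_real ((2 * y) ^ (2 * j))) = mellin_poly s (2 * y)"
    unfolding mellin_poly_def
  proof (rule sum.cong[OF refl])
    fix j assume "j \<in> {1..m1 s}"
    then have "real j \<le> real (m1 s)" by simp
    then have "Re (s - 2 * of_nat j) > 0" using assms by simp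
    from Phi_minus1_half_eq[OF this]
    show "(-1) ^ (j - 1) * Gamma (s - 2 * of_nat j) * Phi_minus1 (s - 2 * of_nat j) (1/2)
             * of_real ((2 * y) ^ (2 * j))
        = (-1) ^ (j - 1) * sech_mellin (s - 2 * of_nat j) * of_real ((2 * y) ^ (2 * j))"
      by (simp only: mult.assoc)
  qed
  moreover have "(\<Sum>n. of_real (pi * (of_nat n + 1/2)) powr (s - 2 * of_nat (m1 s) - 1)
             * sin (of_real pi * (of_nat n + 1/2) + of_real pi * s / 2)
             * of_real (extend {x. x\<^sup>2 = (pi * (of_nat n + 1/2))\<^sup>2}
                          (\<lambda>x. cos x / (x\<^sup>2 - (pi * (of_nat n + 1/2))\<^sup>2)) y))
      = cos (of_real pi * s / 2) * cos_series (s - 2 * of_nat (m1 s)) y"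
  proof -
    have "Re (s - 2 * of_nat (m1 s)) < 2" using assms by simp
    from summable_norm_cancel[OF summable_cos_series[OF this, of y]]
    have *: "summable (\<lambda>n. of_real (half_pi n) powr (s - 2 * of_nat (m1 s) - 1) * of_real ((-1) ^ n * cos_kernel n y))" .
    show ?thesis
      unfolding half_pi_def[symmetric] cos_kernel_def[symmetric] cos_series_def suminf_mult[OF *, symmetric] sin_shift_half_pi
      by (simp add: mult_ac)
  qed
  ultimately show ?thesis unfolding g1_half_def by (simp only:)
qed

text \<open>In the polynomial part 4^z Gamma(z) L(z) = 2^z K(z) at z = s - 2j, and doubling the
  argument supplies the missing 2^(2j). In the series only odd indices 2k + 1 survive, and
  \<open>sin_kernel_eq\<close> reduces them to \<open>cos_series\<close>.\<close>

lemma gamma4_double_eq: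
  assumes "2 * real (m1 s) < Re s" "Re s < 2 * real (m1 s) + 2"
  shows "gamma4 s (2 * y) = of_real (2 * sin y) * (2 powr s * g1_half s y)"
proof -
  define m where "m = m1 s"
  define w where "w = s - 2 * of_nat m"
  define c where "c = cos (of_real pi * s / 2)"
  have w: "Re w < 2" using assms by (simp add: w_def m_def)
  have poly: "(\<Sum>j=1..m1 s. 4 powr (s - 2 * of_nat j) * (-1) ^ (j - 1)
             * Gamma (s - 2 * of_nat j) * L_chi4 (s - 2 * of_nat j)
             * of_real ((2 * (2 * y)) ^ (2 * j))) = 2 powr s * mellin_poly s (2 * y)"
    unfolding mellin_poly_def sum_distrib_left
  proof (rule sum.cong[OF refl])
    fix j assume "j \<in> {1..m1 s}"
    then have "real j \<le> real (m1 s)" by simp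
    then have "Re (s - 2 * of_nat j) > 0" using assms by simp
    note L = L_chi4_eq[OF this]
    let ?z = "s - 2 * of_nat j"
    have "4 powr ?z * (-1) ^ (j - 1) * Gamma ?z * L_chi4 ?z * of_real ((2 * (2 * y)) ^ (2 * j))
        = (2 powr ?z * 2 powr ?z) * (-1) ^ (j - 1) * (Gamma ?z * L_chi4 ?z) * (2 ^ (2 * j) * of_real ((2 * y) ^ (2 * j)))"
      unfolding four_powr power_mult_distrib[of 2 "2 * y"] by simp
    also have "\<dots> = (2 powr ?z * 2 ^ (2 * j)) * ((-1) ^ (j - 1) * sech_mellin ?z * of_real ((2 * y) ^ (2 * j)))"
      unfolding L by simp
    also have "\<dots> = 2 powr s * ((-1) ^ (j - 1) * sech_mellin ?z * of_real ((2 * y) ^ (2 * j)))"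
      unfolding two_powr_diff ..
    finally show "4 powr ?z * (-1) ^ (j - 1) * Gamma ?z * L_chi4 ?z * of_real ((2 * (2 * y)) ^ (2 * j))
        = 2 powr s * ((-1) ^ (j - 1) * sech_mellin ?z * of_real ((2 * y) ^ (2 * j)))" .
  qed
  define f where "f = (\<lambda>n::nat. of_real (pi * of_nat n) powr (s - 2 * of_nat m - 1)
             * (\<Sum>l=1..3. chi4 l * sin (of_real pi * of_nat n * of_int l / 2 + of_real pi * s / 2))
             * of_real (extend {x. x\<^sup>2 = (pi * of_nat n)\<^sup>2}
                          (\<lambda>x. sin x / (x\<^sup>2 - (pi * of_nat n)\<^sup>2)) (2 * y)))"
  let ?t = "\<lambda>k. of_real (half_pi k) powr (w - 1) * complex_of_real ((-1) ^ k * cos_kernel k y)"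
  have fk: "f (2 * k + 1) = 2 powr (w - 1) * of_real (sin y) * c * ?t k" for k
  proof -
    have 1: "complex_of_real (pi * of_nat (2 * k + 1)) powr (w - 1) = 2 powr (w - 1) * of_real (half_pi k) powr (w - 1)"
      using of_real_powr_mult[of 2 "half_pi k" "w - 1"] half_pi_pos[of k]
      by (simp add: half_pi_def algebra_simps)
    have a1: "of_real pi * of_nat (2 * k + 1) * of_int 1 / 2 + of_real pi * s / 2
        = of_real pi * (of_nat k + 1 / 2) + of_real pi * s / 2"
      by (simp add: algebra_simps add_divide_distrib)
    \<comment> \<open>As 3 (2k + 1)/2 = (3k + 1) + 1/2, the l = 3 sine has sign (-1)^(3k+1) =
      -(-1)^k; with chi(3) = -1 it doubles the l = 1 term.\<close>
    have a3: "of_real pi * of_nat (2 * k + 1) * of_int 3 / 2 + of_real pi * s / 2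
        = of_real pi * (of_nat (3 * k + 1) + 1 / 2) + of_real pi * s / 2"
      by (simp add: algebra_simps add_divide_distrib)
    have 2: "(\<Sum>l=1..3. chi4 l * sin (of_real pi * of_nat (2 * k + 1) * of_int l / 2 + of_real pi * s / 2)) = 2 * (-1) ^ k * c"
      unfolding chi4_sum a1 a3 sin_shift_half_pi by (simp add: c_def power_mult power_add)
    show ?thesis
      unfolding f_def sin_kernel_eq 2 1[unfolded w_def] w_def by simp
  qed
  have A: "{n::nat. 1 \<le> n \<and> int n \<notin> E_chi4} = range (\<lambda>k. 2 * k + 1)"
    unfolding mem_E_chi4_iff by (auto elim!: oddE)
  have sumt: "summable (\<lambda>k. norm (?t k))" by (rule summable_cos_series[OF w])
  then have "(\<lambda>k. ?t k) sums cos_series w y"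
    unfolding cos_series_def by (intro summable_sums) (rule summable_norm_cancel)
  \<comment> \<open>Absolute convergence identifies the ordered series of \<open>g1_half\<close>
    with the unordered sum of \<open>gamma4\<close>, which is then reindexed over the odd
    numbers.\<close>
  then have "(?t has_sum cos_series w y) UNIV"
    by (rule norm_summable_imp_has_sum[OF sumt])
  then have "((\<lambda>k. 2 powr (w - 1) * of_real (sin y) * c * ?t k) has_sum (2 powr (w - 1) * of_real (sin y) * c * cos_series w y)) UNIV"
    by (rule has_sum_cmult_right)
  then have "((f \<circ> (\<lambda>k. 2 * k + 1)) has_sum (2 powr (w - 1) * of_real (sin y) * c * cos_series w y)) UNIV"
    by (simp only: o_def fk)
  then have series: "(\<Sum>\<^sub>\<infinity>n\<in>{n::nat. 1 \<le> n \<and> int n \<notin> E_chi4}. f n) = 2 powr (w - 1) * of_real (sin y) * c * cos_series w y"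
    unfolding A by (subst infsum_reindex) (auto simp: inj_on_def intro: infsumI)
  \<comment> \<open>Powers of two: 2(m + 1) + (w - 1) = s + 1, since w = s - 2m.\<close>
  have p: "complex_of_real ((2 * y) ^ (2 * (m + 1))) * 2 powr (w - 1) = 2 * 2 powr s * of_real (y ^ (2 * (m + 1)))"
  proof -
    have "(2::complex) powr w = 2 powr (w - 1) * 2"
      using powr_add[of "2::complex" "w - 1" 1] by simp
    moreover have "(2::complex) powr w * 2 ^ (2 * m) = 2 powr s"
      unfolding w_def by (rule two_powr_diff)
    ultimately have "(2::complex) powr s = 2 powr (w - 1) * 2 * 2 ^ (2 * m)" by (simp only:)
    then show ?thesis by (simp add: power_mult_distrib)
  qed
  have alg: "- (2 * a * b * (p * M) + q * p / D * (2 * p * Y) * (a * d * T)) = 2 * a * (p * - (b * M + q * p * Y / D * (d * T)))"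
    for a b p q M D Y d T :: complex
    by (simp add: algebra_simps)
  have "gamma4 s (2 * y) = - (of_real (sin (2 * y)) * (2 powr s * mellin_poly s (2 * y))
     + of_real pi * 2 powr s * of_real ((2 * y) ^ (2 * (m + 1))) / sin (of_real pi * s)
       * (2 powr (w - 1) * of_real (sin y) * c * cos_series w y))"
    unfolding gamma4_def poly series[unfolded f_def m_def] m_def ..
  also have "\<dots> = - (of_real (sin (2 * y)) * (2 powr s * mellin_poly s (2 * y))
     + of_real pi * 2 powr s / sin (of_real pi * s) * (of_real ((2 * y) ^ (2 * (m + 1))) * 2 powr (w - 1)) * (of_real (sin y) * c * cos_series w y))"
    by simp
  also have "\<dots> = of_real (2 * sin y) * (2 powr s * g1_half s y)"
    unfolding p g1_half_eq[OF assms] m_def[symmetric] w_def[symmetric] c_def[symmetric] sin_double of_real_mult of_real_numeral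
    by (rule alg)
  finally show ?thesis .
qed

text \<open>For l = 1 and l = 3 the arguments are -y and y, so the odd sine contributes -2 sin y and
  the even cosine cancels.\<close>

lemma phi4_double_eq: "phi4 s (2 * y) = of_real (2 * sin y) * (2 powr s * f1_half s y)"
proof -
  have p: "complex_of_real \<bar>2 * y\<bar> powr s = 2 powr s * of_real \<bar>y\<bar> powr s"
    using of_real_powr_mult[of 2 "\<bar>y\<bar>" s] by (cases "y = 0") (auto simp: abs_mult)
  have s: "(\<Sum>l=1..3. chi4 l * complex_of_real (sin ((of_int l / 2 - 1) * (2 * y)))) = - 2 * of_real (sin y)"
    unfolding chi4_sum by simp
  have c: "(\<Sum>l=1..3. chi4 l * complex_of_real (cos ((of_int l / 2 - 1) * (2 * y)))) = 0"
    unfolding chi4_sum by simp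
  show ?thesis unfolding phi4_def f1_half_def p s c by simp
qed

lemma f1_half_tendsto:
  assumes "Re s > 0"
  shows "(f1_half s \<longlongrightarrow> f1_half s y) (at y)"
proof -
  have "continuous_on UNIV (\<lambda>y. complex_of_real \<bar>y\<bar> powr s)"
    using assms by (intro continuous_on_powr_complex continuous_intros) auto
  then have "((\<lambda>y. complex_of_real \<bar>y\<bar> powr s) \<longlongrightarrow> complex_of_real \<bar>y\<bar> powr s) (at y)"
    by (simp add: continuous_on_def)
  then have "((\<lambda>y. of_real pi * 2 powr (s - 2) * complex_of_real \<bar>y\<bar> powr s / sin (of_real pi * s / 2))
      \<longlongrightarrow> of_real pi * 2 powr (s - 2) * complex_of_real \<bar>y\<bar> powr s / sin (of_real pi * s / 2)) (at y)"
    unfolding divide_inverse by (intro tendsto_mult tendsto_const)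
  then show ?thesis unfolding f1_half_def[abs_def] .
qed

lemma g1_half_tendsto:
  assumes "2 * real (m1 s) < Re s" "Re s < 2 * real (m1 s) + 2"
  shows "(g1_half s \<longlongrightarrow> g1_half s y) (at y)"
proof -
  have "Re (s - 2 * of_nat (m1 s)) < 2" using assms by simp
  note c = cos_series_tendsto[OF this, of y]
  show ?thesis
    unfolding g1_half_eq[OF assms, abs_def] mellin_poly_def divide_inverse
    by (intro tendsto_intros c)
qed

text \<open>Off the zeros of the sine the quotient is \<open>G\<close>; at a zero its limit is that
  of \<open>G\<close>, which is the value of \<open>G\<close> by continuity.\<close>

lemma extend_quotient_eq:
  fixes F G :: "real \<Rightarrow> complex"
  assumes F: "\<And>y. F y = of_real (2 * sin y) * G y"
    and G: "\<And>y. (G \<longlongrightarrow> G y) (at y)"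
  shows "extend {y. sin y = 0} (\<lambda>y. F y / of_real (P4 y)) = G"
proof
  fix y
  have ne: "F x / of_real (P4 x) = G x" if "sin x \<noteq> 0" for x
    using that by (simp add: F P4_def)
  show "extend {y. sin y = 0} (\<lambda>y. F y / of_real (P4 y)) y = G y"
  proof (cases "sin y = 0")
    case True
    then have "cos y \<noteq> 0" using sin_cos_squared_add[of y] by auto
    \<comment> \<open>The zeros of the sine are simple: the difference quotient tends to cos y,
      which is nonzero there, so sin x is nonzero in a punctured neighbourhood.\<close>
    moreover have "((\<lambda>x. (sin x - sin y) / (x - y)) \<longlongrightarrow> cos y) (at y)"
      using DERIV_sin[of y] by (simp add: has_field_derivative_iff)
    ultimately have "\<forall>\<^sub>F x in at y. (sin x - sin y) / (x - y) \<noteq> 0"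
      by (rule tendsto_imp_eventually_ne[rotated])
    then have "\<forall>\<^sub>F x in at y. G x = F x / of_real (P4 x)"
      by eventually_elim (use True in \<open>auto simp: ne\<close>)
    then have "((\<lambda>x. F x / of_real (P4 x)) \<longlongrightarrow> G y) (at y)"
      by (rule Lim_transform_eventually[OF G])
    then show ?thesis by (rule tendsto_imp_extend_eq) (use True in simp)
  next
    case False
    then show ?thesis by (simp add: extend_def ne)
  qed
qed

section \<open>The quotient as a Stieltjes transform, and the limit formula\<close>

text \<open>\<open>sech_mellin_expansion\<close> writes the polynomial part of g as Y^2 J(s, Y)
  minus a multiple of J(w, Y). By \<open>sech_stieltjes_eq\<close> that multiple equals f / cos y
  plus the series part, so both cancel from the quotient.\<close>

lemma quotient_eq_sech_stieltjes:
  assumes s: "0 < Re s" "2 * real (m1 s) < Re s" "Re s < 2 * real (m1 s) + 2" "sin (of_real pi * s) \<noteq> 0"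
    and y: "y \<noteq> 0" "cos y \<noteq> 0"
  shows "(f1_half s y - g1_half s y) / of_real (cos y)
     = of_real ((2 * \<bar>y\<bar>)\<^sup>2) * sech_stieltjes s (2 * \<bar>y\<bar>)"
proof -
  define a where "a = \<bar>y\<bar>"
  define m where "m = m1 s"
  define w where "w = s - 2 * of_nat m"
  have a: "a > 0" "cos a = cos y" using y by (auto simp: a_def abs_if)
  have w: "0 < Re w" "Re w < 2" using s by (auto simp: w_def m_def)
  define S where "S = sin (of_real pi * s / 2)"
  define C where "C = cos (of_real pi * s / 2)"
  define T where "T = (\<Sum>n. complex_of_real (half_pi n) powr (w - 1) * of_real ((-1) ^ n / (a\<^sup>2 - (half_pi n)\<^sup>2)))"
  define k where "k = complex_of_real (cos a)"
  define K where "K = complex_of_real pi * 2 powr s"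
  define A where "A = complex_of_real (a ^ (2 * (m + 1)))"
  have k: "k \<noteq> 0" using y a by (simp add: k_def)
  have SC: "sin (of_real pi * s) = 2 * S * C"
    using sin_double[of "of_real pi * s / 2"] by (simp add: S_def C_def)
  have ne: "S \<noteq> 0" "C \<noteq> 0" using s(4) by (auto simp: SC)
  \<comment> \<open>Only even powers of \<open>y\<close> occur, so \<open>y\<close> may be replaced
    by |y|, the positive number for which the transforms were evaluated.\<close>
  have even: "y ^ (2 * j) = a ^ (2 * j)" for j by (simp add: a_def power_even_abs)
  have poly: "mellin_poly s (2 * y) = of_real ((2 * a)\<^sup>2) * sech_stieltjes s (2 * a)
     - (-1) ^ m * of_real ((2 * a) ^ (2 * (m + 1))) * sech_stieltjes w (2 * a)"
  proof -
    have "mellin_poly s (2 * y) = mellin_poly s (2 * a)"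
      unfolding mellin_poly_def power_mult_distrib even ..
    also have "\<dots> = of_real ((2 * a)\<^sup>2) * sech_stieltjes s (2 * a)
     - (-1) ^ m * of_real ((2 * a) ^ (2 * (m + 1))) * sech_stieltjes w (2 * a)"
      unfolding mellin_poly_def m_def w_def using s a by (intro sech_mellin_expansion) auto
    finally show ?thesis .
  qed
  have "cos_series w y = of_real (cos y) * T"
  proof -
    have "\<bar>(-1::real) ^ n\<bar> \<le> 1" for n by (simp add: power_abs)
    from summable_norm_cancel[OF half_pi_series_summable[where c = "\<lambda>n. (-1) ^ n", OF w(2) this]]
    have *: "summable (\<lambda>n. complex_of_real (half_pi n) powr (w - 1) * of_real ((-1) ^ n / (a\<^sup>2 - (half_pi n)\<^sup>2)))" .
    show ?thesis
      unfolding cos_series_def T_def suminf_mult[OF *, symmetric]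
    proof (intro suminf_cong)
      fix n
      have "cos_kernel n y = cos y / (a\<^sup>2 - (half_pi n)\<^sup>2)"
        using cos_kernel_eq[OF cos_nonzero_half_pi[OF y(2)], of n] by (simp add: a_def)
      then show "of_real (half_pi n) powr (w - 1) * of_real ((-1) ^ n * cos_kernel n y)
          = complex_of_real (cos y) * (of_real (half_pi n) powr (w - 1) * of_real ((-1) ^ n / (a\<^sup>2 - (half_pi n)\<^sup>2)))"
        by simp
    qed
  qed
  then have cs: "cos_series w y = k * T" by (simp add: k_def a)
  \<comment> \<open>Shifting by m pi produces the sign (-1)^m, which cancels the one in front of the
    last transform of the expansion.\<close>
  have sinw: "sin (of_real pi * w / 2) = (-1) ^ m * S"
  proof -
    have "of_real pi * w / 2 = of_real pi * s / 2 - of_nat m * of_real pi"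
      by (simp add: w_def algebra_simps diff_divide_distrib)
    moreover have "sin (u - of_nat n * of_real pi) = (-1) ^ n * sin u" for u :: complex and n
      by (simp only: sin_diff sin_npi_complex cos_npi_complex) simp
    ultimately show ?thesis by (simp only: S_def)
  qed
  have J: "(-1) ^ m * of_real ((2 * a) ^ (2 * (m + 1))) * sech_stieltjes w (2 * a)
     = K / (2 * S) * (A * T + of_real a powr s / (2 * k))"
  proof -
    have p2: "(2::complex) powr (w - 2) * 2 ^ (2 * (m + 1)) = 2 powr s"
      using two_powr_diff[of s "m + 1"] by (simp add: w_def algebra_simps)
    have pa: "A * complex_of_real a powr (w - 2) = of_real a powr s"
    proof -
      have "complex_of_real a powr s = of_real a powr (of_nat (2 * (m + 1)) + (w - 2))"
        by (rule arg_cong) (simp add: w_def)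
      also have "\<dots> = of_real a powr (of_nat (2 * (m + 1))) * of_real a powr (w - 2)" by (rule powr_add)
      also have "complex_of_real a powr (of_nat (2 * (m + 1))) = A"
        using a by (subst powr_nat') (simp_all add: A_def)
      finally show ?thesis ..
    qed
    have sgn: "(-1) ^ m * (X / (2 * ((-1) ^ m * S))) = X / (2 * S)" for X
      by (cases "even m") auto
    have "cos a \<noteq> 0" using y a by simp
    from sech_stieltjes_eq[OF w a(1) this]
    have eq: "sech_stieltjes w (2 * a) = of_real pi * 2 powr (w - 2) / (2 * ((-1) ^ m * S)) * (T + of_real a powr (w - 2) / (2 * k))"
      unfolding sinw T_def[symmetric] k_def[symmetric] .
    have pw: "complex_of_real ((2 * a) ^ (2 * (m + 1))) = 2 ^ (2 * (m + 1)) * A"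
      unfolding A_def power_mult_distrib by simp
    have alg: "e * (n * A) * (p * P / X * Q) = e * (p * (P * n) / X) * (A * Q)" for e n p P X Q :: complex
      by simp
    have "(-1) ^ m * of_real ((2 * a) ^ (2 * (m + 1))) * sech_stieltjes w (2 * a)
      = (-1) ^ m * (of_real pi * (2 powr (w - 2) * 2 ^ (2 * (m + 1))) / (2 * ((-1) ^ m * S)))
         * (A * (T + of_real a powr (w - 2) / (2 * k)))"
      unfolding eq pw by (rule alg)
    also have "\<dots> = K / (2 * S) * (A * T + A * of_real a powr (w - 2) / (2 * k))"
      unfolding p2 sgn K_def by (simp add: distrib_left)
    finally show ?thesis unfolding pa .
  qed
  have f: "f1_half s y / k = K / (2 * S) * (of_real a powr s / (2 * k))"
  proof -
    have "(2::complex) powr s = 2 powr (s - 2) * 4"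
      using two_powr_diff[of s 1] by simp
    moreover have "p * P * x / q / z = p * (P * 4) / (2 * q) * (x / (2 * z))" for p P x q z :: complex
      by simp
    ultimately show ?thesis unfolding f1_half_def K_def S_def[symmetric] a_def[symmetric] by (simp only:)
  qed
  have g: "g1_half s y / k = - (mellin_poly s (2 * y) + K / (2 * S) * (A * T))"
  proof -
    \<comment> \<open>The factor cos(pi s/2) of the series cancels against sin(pi s) = 2 S C,
      leaving the denominator 2 S that f has too.\<close>
    have "K * A / (2 * S * C) * (C * (k * T)) = k * (K / (2 * S) * (A * T))" using ne by simp
    moreover have "- (k * x + k * z) / k = - (x + z)" for x z
      using k by (simp add: distrib_left[symmetric])
    ultimately show ?thesis
      unfolding g1_half_eq[OF s(2,3)] SC C_def[symmetric] m_def[symmetric] w_def[symmetric] even cs a(2)[symmetric]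
        k_def[symmetric] A_def[symmetric] K_def[symmetric]
      by (simp only:)
  qed
  have "(f1_half s y - g1_half s y) / k = of_real ((2 * a)\<^sup>2) * sech_stieltjes s (2 * a)"
    unfolding diff_divide_distrib f g poly J by (simp add: distrib_left)
  then show ?thesis by (simp add: k_def a(2) a_def)
qed

theorem corollary2p12:
  fixes s :: complex
  assumes "Re s > 0"
    and "\<forall>k::nat. k \<ge> 1 \<longrightarrow> Re s \<noteq> 2 * real k"
    and "s \<notin> \<nat>"
  shows "phi4_star s = (\<lambda>y. 2 powr s * f1_half s y)
       \<and> gamma4_star s = (\<lambda>y. 2 powr s * g1_half s y)
       \<and> (\<exists>l. ((\<lambda>y. (phi4_star s y - gamma4_star s y) / complex_of_real (cos y)) \<longlongrightarrow> l)
               (inf at_infinity (principal {y::real. cos y \<noteq> 0}))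
            \<and> L_chi4 s = 1 / (4 powr s * Gamma s) * l)"
proof -
  note m = Re_m1[OF assms(1,2)]
  have phi: "phi4_star s = (\<lambda>y. 2 powr s * f1_half s y)"
    unfolding phi4_star_def
    by (rule extend_quotient_eq[OF phi4_double_eq]) (intro tendsto_mult_left f1_half_tendsto assms(1))
  have gamma: "gamma4_star s = (\<lambda>y. 2 powr s * g1_half s y)"
    unfolding gamma4_star_def
    by (rule extend_quotient_eq[OF gamma4_double_eq[OF m]]) (intro tendsto_mult_left g1_half_tendsto m)
  \<comment> \<open>A zero would make s an integer, and a natural number since Re s > 0.\<close>
  have sin_ne: "sin (of_real pi * s) \<noteq> 0"
  proof
    assume "sin (of_real pi * s) = 0"
    then obtain i :: int where "of_real pi * s = of_real (of_int i * pi)"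
      by (auto simp: sin_eq_0)
    then have "s = of_int i" by simp
    then have "s = of_nat (nat i)" using assms(1) by simp
    then show False using assms(3) by simp
  qed
  \<comment> \<open>The identity holds for all nonzero \<open>y\<close> with nonzero cosine; the
    threshold 1 only excludes y = 0.\<close>
  have ev: "\<forall>\<^sub>F y in inf at_infinity (principal {y::real. cos y \<noteq> 0}).
     2 powr s * (of_real ((2 * \<bar>y\<bar>)\<^sup>2) * sech_stieltjes s (2 * \<bar>y\<bar>))
       = (phi4_star s y - gamma4_star s y) / complex_of_real (cos y)"
    unfolding eventually_inf_principal
  proof (rule eventually_at_infinityI[of 1], intro impI)
    fix y :: real assume "norm y \<ge> 1" "y \<in> {y. cos y \<noteq> 0}"
    then have "y \<noteq> 0" "cos y \<noteq> 0" by auto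
    from quotient_eq_sech_stieltjes[OF assms(1) m sin_ne this]
    show "2 powr s * (of_real ((2 * \<bar>y\<bar>)\<^sup>2) * sech_stieltjes s (2 * \<bar>y\<bar>))
       = (phi4_star s y - gamma4_star s y) / complex_of_real (cos y)"
      unfolding phi gamma right_diff_distrib[symmetric] times_divide_eq_right[symmetric] by (simp only:)
  qed
  have "filterlim (\<lambda>y::real. 2 * \<bar>y\<bar>) at_top at_infinity"
    using filterlim_tendsto_pos_mult_at_top[OF tendsto_const _ filterlim_norm_at_top[where 'a = real], of 2]
    by (simp only: real_norm_def)
  then have "((\<lambda>y. of_real ((2 * \<bar>y\<bar>)\<^sup>2) * sech_stieltjes s (2 * \<bar>y\<bar>)) \<longlongrightarrow> sech_mellin s) at_infinity"
    by (rule filterlim_compose[OF sech_stieltjes_tendsto[OF assms(1)]])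
  then have "((\<lambda>y. 2 powr s * (of_real ((2 * \<bar>y\<bar>)\<^sup>2) * sech_stieltjes s (2 * \<bar>y\<bar>))) \<longlongrightarrow> 2 powr s * sech_mellin s)
     (inf at_infinity (principal {y::real. cos y \<noteq> 0}))"
    by (intro tendsto_mult_left tendsto_mono[OF inf_le1])
  from Lim_transform_eventually[OF this ev]
  have "((\<lambda>y. (phi4_star s y - gamma4_star s y) / complex_of_real (cos y)) \<longlongrightarrow> 2 powr s * sech_mellin s)
     (inf at_infinity (principal {y::real. cos y \<noteq> 0}))" .
  \<comment> \<open>Since 4^s = 2^s 2^s, the limit 2^s K(s) divided by 4^s Gamma(s) is K(s) / (2^s
    Gamma(s)), the value of the L-series.\<close>
  moreover have "L_chi4 s = 1 / (4 powr s * Gamma s) * (2 powr s * sech_mellin s)"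
  proof -
    have "L_chi4 s = sech_mellin s / 2 powr s / Gamma s"
      using L_chi4_eq[OF assms(1)] Gamma_nonzero_Re_pos[OF assms(1)] by (simp add: field_simps)
    then show ?thesis by (simp add: four_powr)
  qed
  ultimately show ?thesis using phi gamma by blast
qed

end
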